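(* Let $0\le k$, $2k\le n$. Let $w$ be a row strict tableau of shape $(n-k,k)$ and let $S$ be a standard tableau of shape $(n-k,k)$ with associated cup diagram $C=\mathbf m(S)$. The torus fixed point $\mathcal F_\bullet(w)$ lies in the irreducible component $Y_S$ if and only if $wC$ is an oriented cup diagram. In particular, every irreducible component contains exactly $2^k$ torus fixed points.
   Context: $V=\mathbb C^n$ has basis $p_1,\dots,p_{n-k},q_1,\dots,q_k$; $N p_i=p_{i-1}$, $N q_i=q_{i-1}$, $p_0=q_0=0$. The Springer fiber $Y$ consists of complete flags $F_\bullet$ in $V$ with $NF_i\subset F_{i-1}$. The torus $(\mathbb C^* )^2$ acts on $Y$ via $(r,s)\cdot p_i=rp_i$, $(r,s)\cdot q_i=sq_i$. A row strict tableau $w$ of shape $(n-k,k)$ is a filling by $1,\dots,n$ with rows (top of length $n-k$, bottom of length $k$) decreasing; it is standard if columns also decrease. $w_\wedge,w_\vee$ denote the sets of entries of the top and bottom row; the weight sequence of $w$ has $\wedge$ at $i\in w_\wedge$ and $\vee$ at $i\in w_\vee$. $\mathcal F_\bullet(w)$ is the flag whose $i$-th space is spanned by $p_j$ $(j\le t_i)$ and $q_r$ $(r\le b_i)$, where $t_i,b_i$ are the numbers of entries of $w$ that are $\le i$ in the top, bottom row; these flags are the torus fixed points of $Y$. For $S$ standard, $\mathbf m(S)$ is the unique crossingless matching of the points $1,\dots,n$ ($k$ cups below the points, $n-2k$ downward rays, no crossings) for which $S_\vee$ is the set of left endpoints of cups; $\sigma:S_\vee\to S_\wedge$ sends the left end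 of a cup to its right end, $\delta(i)=(\sigma(i)-i+1)/2$. With $t_i,b_i$ computed for $S$, the component $Y_S$ is the set of flags in $Y$ with $N^{\delta(i)}(F_{\sigma(i)})=F_{i-1}$ for all $i\in S_\vee$ and $F_i=N^{-b_i}(\operatorname{im}N^{\,n-k-t_i+b_i})$ for all $i\in S_\wedge\setminus\sigma(S_\vee)$; the $Y_S$ are precisely the irreducible components of $Y$. $wC$ is the diagram $C$ with the weight sequence of $w$ placed at its points; it is oriented if the two ends of each cup carry opposite symbols (one $\vee$, one $\wedge$). (Since $C$ has $k$ cups, each ray then automatically carries $\wedge$.) *)

theory Defs
  imports Complex_Main "HOL-Library.FuncSet" "HOL-Library.Multiset"
begin

section \<open>Tableaux and weight sequences\<close>

record tableau =
  top_row :: "nat list"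
  bot_row :: "nat list"

definition row_strict :: "nat \<Rightarrow> nat \<Rightarrow> tableau \<Rightarrow> bool" where
  "row_strict n k w \<longleftrightarrow>
     length (top_row w) = n - k \<and> length (bot_row w) = k \<and>
     mset (top_row w @ bot_row w) = mset [1..<Suc n] \<and>
     sorted_wrt (>) (top_row w) \<and> sorted_wrt (>) (bot_row w)"

definition standard :: "nat \<Rightarrow> nat \<Rightarrow> tableau \<Rightarrow> bool" where
  "standard n k S \<longleftrightarrow>
     row_strict n k S \<and> (\<forall>j<k. top_row S ! j > bot_row S ! j)"

definition ups :: "tableau \<Rightarrow> nat set" where
  "ups w = set (top_row w)"

definition downs :: "tableau \<Rightarrow> nat set" where
  "downs w = set (bot_row w)"

definition top_count :: "tableau \<Rightarrow> nat \<Rightarrow> nat" where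
  "top_count w i = card {j \<in> ups w. j \<le> i}"

definition bot_count :: "tableau \<Rightarrow> nat \<Rightarrow> nat" where
  "bot_count w i = card {j \<in> downs w. j \<le> i}"

datatype symbol = Up | Down

text \<open>Only used at the points \<open>1, \<dots>, n\<close>, each of which lies in exactly one row.\<close>

definition weight :: "tableau \<Rightarrow> nat \<Rightarrow> symbol" where
  "weight w i = (if i \<in> downs w then Down else Up)"


section \<open>Cup diagrams\<close>

text \<open>
  A diagram is given by its set of cups \<open>(a, b)\<close>, \<open>a\<close> being the left end; every point of
  \<open>{1..n}\<close> that is not an end of a cup carries a ray. Cups \<open>a < c < b < d\<close> would cross, and a ray
  crosses every cup that passes over its point (rays go down to infinity).
\<close>

definition crossingless_matching :: "nat \<Rightarrow> nat \<Rightarrow> (nat \<times> nat) set \<Rightarrow> bool" where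
  "crossingless_matching n k C \<longleftrightarrow>
     (\<forall>(a, b) \<in> C. 1 \<le> a \<and> a < b \<and> b \<le> n) \<and>
     card C = k \<and>
     (\<forall>(a, b) \<in> C. \<forall>(c, d) \<in> C. (a, b) \<noteq> (c, d) \<longrightarrow> {a, b} \<inter> {c, d} = {}) \<and>
     (\<forall>(a, b) \<in> C. \<forall>(c, d) \<in> C. \<not> (a < c \<and> c < b \<and> b < d)) \<and>
     (\<forall>(a, b) \<in> C. \<forall>c. a < c \<and> c < b \<longrightarrow> c \<in> fst ` C \<union> snd ` C)"

definition matching :: "nat \<Rightarrow> nat \<Rightarrow> tableau \<Rightarrow> (nat \<times> nat) set" where
  "matching n k S = (THE C. crossingless_matching n k C \<and> fst ` C = downs S)"

definition right_end :: "nat \<Rightarrow> nat \<Rightarrow> tableau \<Rightarrow> nat \<Rightarrow> nat" where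
  "right_end n k S i = (THE j. (i, j) \<in> matching n k S)"

definition half_width :: "nat \<Rightarrow> nat \<Rightarrow> tableau \<Rightarrow> nat \<Rightarrow> nat" where
  "half_width n k S i = (right_end n k S i - i + 1) div 2"

definition oriented :: "(nat \<Rightarrow> symbol) \<Rightarrow> (nat \<times> nat) set \<Rightarrow> bool" where
  "oriented x C \<longleftrightarrow> (\<forall>(a, b) \<in> C. x a \<noteq> x b)"


section \<open>The Springer fiber\<close>

text \<open>
  The type \<open>'v\<close> is the complex vector space with the basis \<open>p 1, \<dots>, p (n - k), q 1, \<dots>, q k\<close>.
  It has dimension \<open>n\<close> provided that \<open>k \<le> n\<close>.
\<close>

locale two_block = vector_space scale
  for scale :: "complex \<Rightarrow> 'v::ab_group_add \<Rightarrow> 'v" (infixr "*s" 75) +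
  fixes n k :: nat and p q :: "nat \<Rightarrow> 'v"
  assumes inj_p: "inj_on p {1..n - k}"
    and inj_q: "inj_on q {1..k}"
    and disjoint_pq: "p ` {1..n - k} \<inter> q ` {1..k} = {}"
    and independent_pq: "independent (p ` {1..n - k} \<union> q ` {1..k})"
    and span_pq: "span (p ` {1..n - k} \<union> q ` {1..k}) = UNIV"
    and p_0: "p 0 = 0"
    and q_0: "q 0 = 0"
begin

abbreviation pq_basis :: "'v set" where
  "pq_basis \<equiv> p ` {1..n - k} \<union> q ` {1..k}"

text \<open>The linear map with \<open>p i \<mapsto> f i\<close> and \<open>q i \<mapsto> g i\<close>.\<close>

definition linear_ext :: "(nat \<Rightarrow> 'v) \<Rightarrow> (nat \<Rightarrow> 'v) \<Rightarrow> 'v \<Rightarrow> 'v" where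
  "linear_ext f g v =
     (\<Sum>i = 1..n - k. representation pq_basis v (p i) *s f i) +
     (\<Sum>i = 1..k. representation pq_basis v (q i) *s g i)"

definition N :: "'v \<Rightarrow> 'v" where
  "N = linear_ext (\<lambda>i. p (i - 1)) (\<lambda>i. q (i - 1))"

definition torus :: "complex \<Rightarrow> complex \<Rightarrow> 'v \<Rightarrow> 'v" where
  "torus r s = linear_ext (\<lambda>i. r *s p i) (\<lambda>i. s *s q i)"

lemma linear_ext_p:
  assumes "i \<in> {1..n - k}"
  shows "linear_ext f g (p i) = f i"
proof -
  have r: "representation pq_basis (p i) = (\<lambda>v. if v = p i then 1 else 0)"
    using assms by (intro representation_basis independent_pq) auto
  have ne: "q j \<noteq> p i" if "j \<in> {1..k}" for j
    using assms that disjoint_pq by (metis IntI empty_iff imageI)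
  have eq: "p j = p i \<longleftrightarrow> j = i" if "j \<in> {1..n - k}" for j
    using inj_on_eq_iff[OF inj_p that assms] .
  have "(\<Sum>j = 1..n - k. representation pq_basis (p i) (p j) *s f j)
      = (\<Sum>j = 1..n - k. if j = i then f j else 0)"
    unfolding r by (intro sum.cong refl) (simp add: eq)
  moreover have "(\<Sum>j = 1..k. representation pq_basis (p i) (q j) *s g j) = 0"
    unfolding r by (intro sum.neutral) (simp add: ne)
  ultimately show ?thesis
    using assms by (simp add: linear_ext_def)
qed

lemma linear_ext_q:
  assumes "i \<in> {1..k}"
  shows "linear_ext f g (q i) = g i"
proof -
  have r: "representation pq_basis (q i) = (\<lambda>v. if v = q i then 1 else 0)"
    using assms by (intro representation_basis independent_pq) auto
  have ne: "p j \<noteq> q i" if "j \<in> {1..n - k}" for j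
    using assms that disjoint_pq by (metis IntI empty_iff imageI)
  have eq: "q j = q i \<longleftrightarrow> j = i" if "j \<in> {1..k}" for j
    using inj_on_eq_iff[OF inj_q that assms] .
  have "(\<Sum>j = 1..k. representation pq_basis (q i) (q j) *s g j)
      = (\<Sum>j = 1..k. if j = i then g j else 0)"
    unfolding r by (intro sum.cong refl) (simp add: eq)
  moreover have "(\<Sum>j = 1..n - k. representation pq_basis (q i) (p j) *s f j) = 0"
    unfolding r by (intro sum.neutral) (simp add: ne)
  ultimately show ?thesis
    using assms by (simp add: linear_ext_def)
qed

lemma linear_linear_ext: "Vector_Spaces.linear (*s) (*s) (linear_ext f g)"
proof -
  have add: "linear_ext f g (x + y) = linear_ext f g x + linear_ext f g y" for x y
    by (simp only: linear_ext_def representation_add[OF independent_pq] span_pq UNIV_I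
        scale_left_distrib sum.distrib add.assoc add.left_commute add.commute)
  have scale: "linear_ext f g (c *s x) = c *s linear_ext f g x" for c x
    by (simp only: linear_ext_def representation_scale[OF independent_pq] span_pq UNIV_I
        scale_right_distrib scale_sum_right scale_scale)
  show ?thesis
    by (intro Vector_Spaces.linear.intro module_hom.intro module_hom_axioms.intro
        vector_space_axioms module_axioms add scale)
qed

text \<open>
  Flags \<open>F 0, \<dots>, F n\<close> are extensional functions on \<open>{..n}\<close>, so that two flags are equal as soon
  as their members are.
\<close>

definition complete_flag :: "(nat \<Rightarrow> 'v set) \<Rightarrow> bool" where
  "complete_flag F \<longleftrightarrow>
     F \<in> extensional {..n} \<and>
     (\<forall>i\<le>n. subspace (F i) \<and> dim (F i) = i) \<and>
     (\<forall>i<n. F i \<subseteq> F (Suc i))"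

definition springer_fiber :: "(nat \<Rightarrow> 'v set) set" where
  "springer_fiber = {F. complete_flag F \<and> (\<forall>i\<in>{1..n}. N ` F i \<subseteq> F (i - 1))}"

definition torus_fixed_points :: "(nat \<Rightarrow> 'v set) set" where
  "torus_fixed_points =
     {F \<in> springer_fiber. \<forall>r s. r \<noteq> 0 \<and> s \<noteq> 0 \<longrightarrow> (\<forall>i\<le>n. torus r s ` F i = F i)}"

definition tableau_flag :: "tableau \<Rightarrow> nat \<Rightarrow> 'v set" where
  "tableau_flag w =
     (\<lambda>i\<in>{..n}. span (p ` {1..top_count w i} \<union> q ` {1..bot_count w i}))"

text \<open>
  Explicit description of the irreducible components of the Springer fiber: they are exactly the
  sets \<open>component S\<close>, for \<open>S\<close> standard.
\<close>

definition component :: "tableau \<Rightarrow> (nat \<Rightarrow> 'v set) set" where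
  "component S =
     {F \<in> springer_fiber.
        (\<forall>i \<in> downs S. (N ^^ half_width n k S i) ` F (right_end n k S i) = F (i - 1)) \<and>
        (\<forall>i \<in> ups S - right_end n k S ` downs S.
           F i = (N ^^ bot_count S i) -` range (N ^^ (n - k - top_count S i + bot_count S i)))}"

end

end

theory Submission
  imports Defs
begin

text \<open>
  The flag of a row strict tableau is a flag of coordinate subspaces
  \<open>E t b = \<langle>p 1, \<dots>, p t, q 1, \<dots>, q b\<rangle>\<close>, and both kinds of conditions defining a component can be read
  off on them, because \<open>N ^^ m\<close> lowers both indices by \<open>m\<close> (stopping at \<open>0\<close>) and taking preimages
  raises them again. Let \<open>D\<close> be the bottom row of the tableau.

  For a cup \<open>(a, b)\<close> of half width \<open>d\<close>, the condition \<open>(N ^^ d) ` F b = F (a - 1)\<close> says that \<open>D\<close> contains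
  exactly \<open>d\<close> of the \<open>2 d\<close> points of \<open>{a..b}\<close> (\<open>cup_condition_iff\<close>). Since \<open>{a..b}\<close> is the union of the
  cups nested below \<open>(a, b)\<close>, these conditions for all cups together say that \<open>D\<close> contains exactly one
  end of each cup: one direction is counting, the other one peels off the outermost cup of a nest by
  induction on its width (\<open>splits_iff_balanced\<close>). This is orientedness.

  The rays impose nothing new. As \<open>D\<close> has \<open>k\<close> elements and there are \<open>k\<close> cups, an oriented \<open>D\<close> contains
  no ray point. Hence at a ray \<open>i\<close>, over which no cup passes, \<open>D\<close> and the bottom row of \<open>S\<close> both count the
  cups to the left of \<open>i\<close> (\<open>card_below_ray\<close>), and the space that the component prescribes at \<open>i\<close>
  is the one given by these counts (\<open>ray_condition\<close>).

  For the number of fixed points, a torus-stable subspace is the sum of its intersections with the two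
  Jordan blocks, and an \<open>N\<close>-invariant subspace of a Jordan block is one of the members of its chain. So
  every fixed point is the flag of some \<open>D\<close> (\<open>torus_fixed_point_is_subset_flag\<close>), and different \<open>D\<close>
  give different flags. The \<open>D\<close> that
  occur in the component are obtained by choosing one end of each of the \<open>k\<close> cups
  (\<open>card_splitting_sets\<close>).

  Throughout one needs that the matching of \<open>S\<close> really exists and is unique. Both follow from
  the lattice path that steps up at the points of the bottom row and down at all others: a cup starting
  at \<open>a\<close> has to end where the path first returns to its height before \<open>a\<close>, and for standard \<open>S\<close> the
  path does return.
\<close>


section \<open>Counting in crossingless matchings\<close>

definition cup_ends :: "(nat \<times> nat) set \<Rightarrow> nat set" where
  "cup_ends C = (\<Union>(a, b)\<in>C. {a, b})"

definition cups_within :: "(nat \<times> nat) set \<Rightarrow> nat \<Rightarrow> nat \<Rightarrow> (nat \<times> nat) set" where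
  "cups_within C a b = {(c, d) \<in> C. a \<le> c \<and> d \<le> b}"

text \<open>
  Orientedness in terms of the set \<open>D\<close> of the points that carry a \<open>Down\<close>.
\<close>

definition splits :: "nat set \<Rightarrow> (nat \<times> nat) set \<Rightarrow> bool" where
  "splits D C \<longleftrightarrow> (\<forall>(a, b) \<in> C. (a \<in> D) \<noteq> (b \<in> D))"

lemma cup_ends_eq: "cup_ends C = fst ` C \<union> snd ` C"
  unfolding cup_ends_def by force

lemma matching_finite:
  assumes "crossingless_matching n k C"
  shows "finite C"
proof (rule finite_subset)
  show "C \<subseteq> {1..n} \<times> {1..n}"
    using assms unfolding crossingless_matching_def by fastforce
qed simp

lemma matching_bounds:
  assumes "crossingless_matching n k C" "(a, b) \<in> C"
  shows "1 \<le> a" "a < b" "b \<le> n"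
  using assms unfolding crossingless_matching_def by auto

lemma matching_disjoint:
  assumes "crossingless_matching n k C" "(a, b) \<in> C" "(c, d) \<in> C" "{a, b} \<inter> {c, d} \<noteq> {}"
  shows "a = c \<and> b = d"
proof -
  have "\<forall>(a, b) \<in> C. \<forall>(c, d) \<in> C. (a, b) \<noteq> (c, d) \<longrightarrow> {a, b} \<inter> {c, d} = {}"
    using assms(1) unfolding crossingless_matching_def by (elim conjE)
  from this[rule_format, OF assms(2), simplified, rule_format, OF assms(3)] assms(4)
  show ?thesis by auto
qed

lemma matching_noncrossing:
  assumes "crossingless_matching n k C" "(a, b) \<in> C" "(c, d) \<in> C" "a < c" "c < b"
  shows "d < b"
proof -
  have "\<forall>(a, b) \<in> C. \<forall>(c, d) \<in> C. \<not> (a < c \<and> c < b \<and> b < d)"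
    using assms(1) unfolding crossingless_matching_def by (elim conjE)
  from this[rule_format, OF assms(2), simplified, rule_format, OF assms(3)] assms(4,5)
  have "\<not> b < d" by auto
  moreover have "b \<noteq> d" using matching_disjoint[OF assms(1-3)] assms(4) by auto
  ultimately show ?thesis by simp
qed

lemma matching_covered:
  assumes "crossingless_matching n k C" "(a, b) \<in> C" "a < c" "c < b"
  shows "c \<in> cup_ends C"
proof -
  have "\<forall>(a, b)\<in>C. \<forall>c. a < c \<and> c < b \<longrightarrow> c \<in> fst ` C \<union> snd ` C"
    using assms(1) unfolding crossingless_matching_def by (elim conjE)
  from this[rule_format, OF assms(2), simplified, rule_format, of c] assms(3,4)
  show ?thesis unfolding cup_ends_eq by blast
qed

lemma matching_card: "crossingless_matching n k C \<Longrightarrow> card C = k"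
  unfolding crossingless_matching_def by (elim conjE)

lemma cup_ends_subset:
  assumes "crossingless_matching n k C"
  shows "cup_ends C \<subseteq> {1..n}"
proof
  fix x assume "x \<in> cup_ends C"
  then obtain a b where ab: "(a, b) \<in> C" "x = a \<or> x = b"
    by (auto simp: cup_ends_def)
  thus "x \<in> {1..n}" using matching_bounds[OF assms ab(1)] by auto
qed

lemma card_cup_ends_Int:
  assumes cm: "crossingless_matching n k C" and sub: "C' \<subseteq> C"
    and D: "\<And>a b. (a, b) \<in> C' \<Longrightarrow> card ({a, b} \<inter> D) = m"
  shows "card (cup_ends C' \<inter> D) = m * card C'"
proof -
  have fin: "finite C'"
    using finite_subset[OF sub matching_finite[OF cm]] .
  have "cup_ends C' \<inter> D = (\<Union>x\<in>C'. {fst x, snd x} \<inter> D)"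
    by (force simp: cup_ends_def)
  also have "card \<dots> = (\<Sum>x\<in>C'. card ({fst x, snd x} \<inter> D))"
  proof (rule card_UN_disjoint[OF fin])
    show "\<forall>x\<in>C'. \<forall>y\<in>C'. x \<noteq> y \<longrightarrow> {fst x, snd x} \<inter> D \<inter> ({fst y, snd y} \<inter> D) = {}"
    proof (intro ballI impI)
      fix x y assume "x \<in> C'" "y \<in> C'" "x \<noteq> y"
      hence "{fst x, snd x} \<inter> {fst y, snd y} = {}"
        using matching_disjoint[OF cm, of "fst x" "snd x" "fst y" "snd y"] sub
        by (metis prod.collapse subsetD)
      thus "{fst x, snd x} \<inter> D \<inter> ({fst y, snd y} \<inter> D) = {}" by blast
    qed
  qed auto
  also have "\<dots> = (\<Sum>x\<in>C'. m)"
    by (rule sum.cong) (use D in force)+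
  finally show ?thesis by simp
qed

lemma card_cup_ends:
  assumes cm: "crossingless_matching n k C" and sub: "C' \<subseteq> C"
  shows "card (cup_ends C') = 2 * card C'"
proof -
  have "card ({a, b} \<inter> UNIV) = 2" if "(a, b) \<in> C'" for a b
    using matching_bounds(2)[OF cm subsetD[OF sub that]] by simp
  from card_cup_ends_Int[OF cm sub this] show ?thesis by simp
qed

lemma card_cup_ends_splits:
  assumes cm: "crossingless_matching n k C" and sub: "C' \<subseteq> C" and D: "splits D C'"
  shows "card (cup_ends C' \<inter> D) = card C'"
proof -
  have "card ({a, b} \<inter> D) = 1" if "(a, b) \<in> C'" for a b
    using D that unfolding splits_def by (cases "a \<in> D") auto
  from card_cup_ends_Int[OF cm sub this] show ?thesis by simp
qed

text \<open>
  Every point under a cup lies on a cup, and the partner of such a point cannot lie outside without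
  crossing.
\<close>

lemma cup_ends_cups_within:
  assumes cm: "crossingless_matching n k C" and ab: "(a, b) \<in> C"
  shows "cup_ends (cups_within C a b) = {a..b}"
proof
  show "cup_ends (cups_within C a b) \<subseteq> {a..b}"
    by (auto simp: cup_ends_def cups_within_def dest: matching_bounds(2)[OF cm])
  show "{a..b} \<subseteq> cup_ends (cups_within C a b)"
  proof
    fix c assume c: "c \<in> {a..b}"
    show "c \<in> cup_ends (cups_within C a b)"
    proof (cases "c = a \<or> c = b")
      case True
      thus ?thesis using ab by (auto simp: cup_ends_def cups_within_def)
    next
      case False
      hence c': "a < c" "c < b" using c by auto
      then obtain e f where ef: "(e, f) \<in> C" "c = e \<or> c = f"
        using matching_covered[OF cm ab] unfolding cup_ends_def by blast
      have "a \<le> e \<and> f \<le> b"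
      proof (cases "c = e")
        case True
        thus ?thesis using matching_noncrossing[OF cm ab ef(1)] c' by auto
      next
        case False
        hence f: "c = f" using ef by auto
        have "\<not> e < a" using matching_noncrossing[OF cm ef(1) ab] f c' by auto
        thus ?thesis using f c' by auto
      qed
      thus ?thesis using ef by (auto simp: cup_ends_def cups_within_def)
    qed
  qed
qed

lemma cup_width:
  assumes cm: "crossingless_matching n k C" and ab: "(a, b) \<in> C"
  shows "b + 1 - a = 2 * card (cups_within C a b)"
  using card_cup_ends[OF cm, of "cups_within C a b"] cup_ends_cups_within[OF cm ab]
  by (auto simp: cups_within_def)

text \<open>
  Orientedness can be tested on the intervals below the cups, which is what the geometry of flags sees.
  If all these intervals are balanced, then by induction the cups nested properly below \<open>(a, b)\<close> are split,
  so that they account for all but one of the elements of \<open>D\<close> in \<open>{a..b}\<close>, and exactly one of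
  \<open>a\<close> and \<open>b\<close> is left for \<open>D\<close>.
\<close>

lemma splits_iff_balanced:
  assumes cm: "crossingless_matching n k C"
  shows "splits D C \<longleftrightarrow> (\<forall>(a, b)\<in>C. card ({a..b} \<inter> D) = card (cups_within C a b))"
proof (intro iffI, safe)
  fix a b assume D: "splits D C" and ab: "(a, b) \<in> C"
  have "splits D (cups_within C a b)"
    using D by (auto simp: splits_def cups_within_def)
  thus "card ({a..b} \<inter> D) = card (cups_within C a b)"
    using card_cup_ends_splits[OF cm, of "cups_within C a b"] cup_ends_cups_within[OF cm ab]
    by (auto simp: cups_within_def)
next
  assume bal: "\<forall>(a, b)\<in>C. card ({a..b} \<inter> D) = card (cups_within C a b)"
  have "(a \<in> D) \<noteq> (b \<in> D)" if "(a, b) \<in> C" for a b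
    using that
  proof (induction "b - a" arbitrary: a b rule: less_induct)
    case (less a b)
    note ab = less.prems
    let ?I = "cups_within C a b - {(a, b)}"
    have fin: "finite (cups_within C a b)"
      using matching_finite[OF cm] by (rule rev_finite_subset) (auto simp: cups_within_def)
    have mem: "(a, b) \<in> cups_within C a b"
      using ab by (simp add: cups_within_def)
    have lt: "a < b" by (rule matching_bounds(2)[OF cm ab])
    have sp: "splits D ?I"
      unfolding splits_def
    proof (clarify, goal_cases)
      case (1 c d)
      hence cd: "(c, d) \<in> C" "a \<le> c" "d \<le> b" "(c, d) \<noteq> (a, b)"
        by (auto simp: cups_within_def)
      have "d - c < b - a"
        using cd lt matching_bounds(2)[OF cm cd(1)] by auto
      thus ?case using less.hyps[OF _ cd(1)] 1 by blast
    qed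
    have sub: "?I \<subseteq> C" by (auto simp: cups_within_def)
    have split: "{a..b} = cup_ends ?I \<union> {a, b}"
      using cup_ends_cups_within[OF cm ab] mem by (auto simp: cup_ends_def)
    have disj: "cup_ends ?I \<inter> {a, b} = {}"
      using matching_disjoint[OF cm _ ab] sub by (auto simp: cup_ends_def)
    have fe: "finite (cup_ends ?I)"
      using split by (metis finite_Un finite_atLeastAtMost)
    have "{a..b} \<inter> D = (cup_ends ?I \<inter> D) \<union> ({a, b} \<inter> D)"
      using split by blast
    hence "card ({a..b} \<inter> D) = card (cup_ends ?I \<inter> D) + card ({a, b} \<inter> D)"
      using disj fe by (simp add: card_Un_disjoint disjoint_iff)
    also have "card (cup_ends ?I \<inter> D) = card (cups_within C a b) - 1"
      using card_cup_ends_splits[OF cm sub sp] mem fin by simp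
    finally have "card ({a, b} \<inter> D) = 1"
      using bal ab mem fin card_gt_0_iff[of "cups_within C a b"] by fastforce
    thus ?case using lt by (cases "a \<in> D"; cases "b \<in> D") auto
  qed
  thus "splits D C" unfolding splits_def by blast
qed

lemma splits_fst:
  assumes "crossingless_matching n k C"
  shows "splits (fst ` C) C"
  unfolding splits_def
proof (clarify, goal_cases)
  case (1 a b)
  have "b \<noteq> fst x" if "x \<in> C" for x
    using matching_disjoint[OF assms 1(1), of b "snd x"] matching_bounds(2)[OF assms 1(1)] that
    by (cases x) auto
  thus ?case using 1 by (metis fst_conv imageE image_eqI)
qed

lemma card_fst_matching:
  assumes "crossingless_matching n k C"
  shows "card (fst ` C) = k"
proof -
  have "inj_on fst C"
  proof (rule inj_onI)
    fix x y assume "x \<in> C" "y \<in> C" "fst x = fst y"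
    then obtain a b d where ab: "(a, b) \<in> C" and ad: "(a, d) \<in> C" and xy: "x = (a, b)" "y = (a, d)"
      by (cases x, cases y) auto
    have "a = a \<and> b = d" by (rule matching_disjoint[OF assms ab ad]) simp
    thus "x = y" by (simp add: xy)
  qed
  thus ?thesis using matching_card[OF assms] by (simp add: card_image)
qed

text \<open>
  The \<open>k\<close> cups already use up all \<open>k\<close> elements of \<open>D\<close>.
\<close>

lemma splits_subset_cup_ends:
  assumes cm: "crossingless_matching n k C" and D: "splits D C" "finite D" "card D = k"
  shows "D \<subseteq> cup_ends C"
proof -
  have "card (cup_ends C \<inter> D) = card D"
    using card_cup_ends_splits[OF cm order.refl D(1)] matching_card[OF cm] D by simp
  hence "cup_ends C \<inter> D = D"
    using card_subset_eq[OF D(2), of "cup_ends C \<inter> D"] by blast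
  thus ?thesis by blast
qed

text \<open>
  No cup passes over a ray, so the points of \<open>D\<close> up to \<open>i\<close> are the ends in \<open>D\<close> of the cups to the
  left of \<open>i\<close>, one for each cup. The count does not depend on the choice of \<open>D\<close>.
\<close>

lemma card_below_ray:
  assumes cm: "crossingless_matching n k C" and D: "splits D C" "finite D" "card D = k" "D \<subseteq> {1..n}"
    and i: "i \<notin> cup_ends C"
  shows "card ({1..i} \<inter> D) = card (cups_within C 1 i)"
proof -
  have "{1..i} \<inter> D = cup_ends (cups_within C 1 i) \<inter> D"
  proof (intro set_eqI iffI)
    fix x assume x: "x \<in> {1..i} \<inter> D"
    then obtain a b where ab: "(a, b) \<in> C" "x = a \<or> x = b"
      using splits_subset_cup_ends[OF cm D(1-3)] by (auto simp: cup_ends_def)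
    have "i \<noteq> a" "i \<noteq> b" using i ab by (auto simp: cup_ends_def)
    have "b \<le> i"
    proof (rule ccontr)
      assume "\<not> b \<le> i"
      hence "a < i" "i < b" using ab x \<open>i \<noteq> a\<close> by auto
      thus False using matching_covered[OF cm ab(1)] i by blast
    qed
    thus "x \<in> cup_ends (cups_within C 1 i) \<inter> D"
      using x ab matching_bounds[OF cm ab(1)] by (auto simp: cup_ends_def cups_within_def)
  next
    fix x assume "x \<in> cup_ends (cups_within C 1 i) \<inter> D"
    then obtain a b where ab: "(a, b) \<in> C" "1 \<le> a" "b \<le> i" "x = a \<or> x = b" "x \<in> D"
      by (auto simp: cup_ends_def cups_within_def)
    thus "x \<in> {1..i} \<inter> D"
      using matching_bounds[OF cm ab(1)] by auto
  qed
  moreover have "splits D (cups_within C 1 i)"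
    using D by (auto simp: splits_def cups_within_def)
  ultimately show ?thesis
    using card_cup_ends_splits[OF cm, of "cups_within C 1 i" D] by (auto simp: cups_within_def)
qed

text \<open>
  A subset \<open>A\<close> of the cups encodes the choice of the left end for the cups in \<open>A\<close> and of the right end
  for the others.
\<close>

lemma card_splitting_sets:
  assumes cm: "crossingless_matching n k C"
  shows "card {D. D \<subseteq> {1..n} \<and> card D = k \<and> splits D C} = 2 ^ k"
proof -
  let ?f = "\<lambda>A. fst ` A \<union> snd ` (C - A)"
  have f_fst: "a \<in> ?f A \<longleftrightarrow> (a, b) \<in> A" if "A \<subseteq> C" "(a, b) \<in> C" for A a b
  proof
    assume "a \<in> ?f A"
    thus "(a, b) \<in> A"
    proof (elim UnE imageE)
      fix x assume "a = fst x" "x \<in> A"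
      thus ?thesis using matching_disjoint[OF cm that(2), of a "snd x"] that(1) by (cases x) auto
    next
      fix x assume x: "a = snd x" "x \<in> C - A"
      thus ?thesis
        using matching_disjoint[OF cm that(2), of "fst x" a] matching_bounds(2)[OF cm, of "fst x" "snd x"]
        by (cases x) auto
    qed
  qed force
  have f_snd: "b \<in> ?f A \<longleftrightarrow> (a, b) \<notin> A" if "A \<subseteq> C" "(a, b) \<in> C" for A a b
  proof
    assume "b \<in> ?f A"
    thus "(a, b) \<notin> A"
    proof (elim UnE imageE)
      fix x assume x: "b = fst x" "x \<in> A"
      thus ?thesis
        using matching_disjoint[OF cm that(2), of b "snd x"] matching_bounds(2)[OF cm that(2)] that(1)
        by (cases x) auto
    next
      fix x assume "b = snd x" "x \<in> C - A"
      thus ?thesis using matching_disjoint[OF cm that(2), of "fst x" b] by (cases x) auto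
    qed
  qed (use that in force)
  have "bij_betw ?f (Pow C) {D. D \<subseteq> {1..n} \<and> card D = k \<and> splits D C}"
  proof (rule bij_betwI')
    fix A B assume AB: "A \<in> Pow C" "B \<in> Pow C"
    show "(?f A = ?f B) = (A = B)"
    proof
      assume eq: "?f A = ?f B"
      have "x \<in> A \<longleftrightarrow> x \<in> B" if "x \<in> C" for x
        using f_fst[of A "fst x" "snd x"] f_fst[of B "fst x" "snd x"] AB that eq by auto
      thus "A = B" using AB by blast
    qed simp
  next
    fix A assume A: "A \<in> Pow C"
    have sub: "?f A \<subseteq> cup_ends C"
      using A by (auto simp: cup_ends_eq)
    have sp: "splits (?f A) C"
      unfolding splits_def using f_fst[of A] f_snd[of A] A by blast
    have "card (?f A) = k"
      using card_cup_ends_splits[OF cm order.refl sp] sub matching_card[OF cm]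
      by (simp add: Int_absorb1)
    thus "?f A \<in> {D. D \<subseteq> {1..n} \<and> card D = k \<and> splits D C}"
      using sp sub cup_ends_subset[OF cm] by blast
  next
    fix D assume D: "D \<in> {D. D \<subseteq> {1..n} \<and> card D = k \<and> splits D C}"
    hence sub: "D \<subseteq> cup_ends C"
      using splits_subset_cup_ends[OF cm, of D] finite_subset[of D "{1..n}"] by auto
    let ?A = "{x \<in> C. fst x \<in> D}"
    have iff: "x \<in> D \<longleftrightarrow> x \<in> ?f ?A" if x: "x \<in> cup_ends C" for x
    proof -
      obtain a b where ab: "(a, b) \<in> C" "x = a \<or> x = b"
        using x by (auto simp: cup_ends_def)
      have ne: "b \<in> D \<longleftrightarrow> a \<notin> D" using D ab by (auto simp: splits_def)
      have fa: "a \<in> ?f ?A \<longleftrightarrow> a \<in> D"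
        by (subst f_fst[of ?A a b]) (use ab in auto)
      have fb: "b \<in> ?f ?A \<longleftrightarrow> a \<notin> D"
        by (subst f_snd[of ?A a b]) (use ab in auto)
      from ab(2) show ?thesis
      proof
        assume "x = a"
        thus ?thesis by (simp only: fa)
      next
        assume "x = b"
        thus ?thesis by (simp only: fb ne)
      qed
    qed
    have sub': "?f ?A \<subseteq> cup_ends C" unfolding cup_ends_eq by blast
    have "D = ?f ?A"
    proof (intro subset_antisym subsetI)
      fix x assume x: "x \<in> D"
      show "x \<in> ?f ?A" by (rule iffD1[OF iff[OF subsetD[OF sub x]] x])
    next
      fix x assume x: "x \<in> ?f ?A"
      show "x \<in> D" by (rule iffD2[OF iff[OF subsetD[OF sub' x]] x])
    qed
    moreover have "?A \<in> Pow C" by simp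
    ultimately show "\<exists>A\<in>Pow C. D = ?f A" by (rule bexI)
  qed
  hence "card {D. D \<subseteq> {1..n} \<and> card D = k \<and> splits D C} = card (Pow C)"
    by (simp add: bij_betw_same_card)
  thus ?thesis
    using matching_card[OF cm] matching_finite[OF cm] by (simp add: card_Pow)
qed


section \<open>The cup diagram of a ballot sequence\<close>

text \<open>
  The height at \<open>j\<close> of the lattice path that steps up at the points of \<open>D\<close> and down at all other points.
\<close>

definition height :: "nat set \<Rightarrow> nat \<Rightarrow> int" where
  "height D j = int (card ({1..j} \<inter> D)) - int (card ({1..j} - D))"

lemma height_Suc: "height D (Suc j) = height D j + (if Suc j \<in> D then 1 else - 1)"
proof -
  have e: "{1..Suc j} = insert (Suc j) {1..j}" by auto
  show ?thesis
    unfolding height_def e by (auto simp: Int_insert_left insert_Diff_if)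
qed

lemma height_diff:
  assumes "i \<le> j"
  shows "height D j - height D i = int (card ({Suc i..j} \<inter> D)) - int (card ({Suc i..j} - D))"
proof -
  have "card ({1..j} \<inter> D) = card ({1..i} \<inter> D) + card ({Suc i..j} \<inter> D)"
    by (subst card_Un_disjoint[symmetric]) (use assms in \<open>auto intro!: arg_cong[where f = card]\<close>)
  moreover have "card ({1..j} - D) = card ({1..i} - D) + card ({Suc i..j} - D)"
    by (subst card_Un_disjoint[symmetric]) (use assms in \<open>auto intro!: arg_cong[where f = card]\<close>)
  ultimately show ?thesis by (simp add: height_def)
qed

text \<open>
  A cup begins at each up step and ends at the first point where the path is back at its previous height,
  as in the matching of parentheses.
\<close>

definition cup_diagram :: "nat set \<Rightarrow> (nat \<times> nat) set" where
  "cup_diagram D =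
     {(a, b). a \<in> D \<and> a < b \<and> height D b \<le> height D (a - 1) \<and>
        (\<forall>c. a \<le> c \<and> c < b \<longrightarrow> height D (a - 1) < height D c)}"

lemma cup_diagramD:
  assumes "(a, b) \<in> cup_diagram D"
  shows "a \<in> D" "a < b" "height D b \<le> height D (a - 1)"
    "a \<le> c \<Longrightarrow> c < b \<Longrightarrow> height D (a - 1) < height D c"
  using assms unfolding cup_diagram_def by auto

lemma cup_diagram_unique:
  assumes "(a, b) \<in> cup_diagram D" "(a, b') \<in> cup_diagram D"
  shows "b = b'"
  using cup_diagramD(2,3)[OF assms(1)] cup_diagramD(2,3)[OF assms(2)]
    cup_diagramD(4)[OF assms(1), of b'] cup_diagramD(4)[OF assms(2), of b]
  by (cases b b' rule: linorder_cases) auto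

text \<open>
  This gives uniqueness: a crossingless matching is determined by its left ends. The points under a cup
  \<open>(a, b)\<close> are matched among each other. Hence, reading from \<open>a\<close> to some \<open>c < b\<close>, each right end has
  been preceded by its own left end, and the left end \<open>a\<close> is still open, so the path
  stays strictly above its height before \<open>a\<close> until it comes back to it at \<open>b\<close>.
\<close>

lemma matching_eq_cup_diagram:
  assumes cm: "crossingless_matching n k C"
  shows "C = cup_diagram (fst ` C)"
proof -
  let ?D = "fst ` C"
  have sub: "C \<subseteq> cup_diagram ?D"
  proof
    fix x assume "x \<in> C"
    then obtain a b where ab: "(a, b) \<in> C" and x: "x = (a, b)" by (cases x) auto
    have a: "Suc (a - 1) = a" and lt: "a < b" using matching_bounds[OF cm ab] by auto
    have "card ({a..b} \<inter> ?D) = card (cups_within C a b)"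
      using splits_iff_balanced[OF cm] splits_fst[OF cm] ab by blast
    moreover have "card {a..b} = 2 * card (cups_within C a b)"
      using cup_width[OF cm ab] by simp
    moreover have "card {a..b} = card ({a..b} \<inter> ?D) + card ({a..b} - ?D)"
      using card_Int_Diff by blast
    ultimately have "height ?D b \<le> height ?D (a - 1)"
      using height_diff[of "a - 1" b ?D] a lt by simp
    moreover have "height ?D (a - 1) < height ?D c" if c: "a \<le> c" "c < b" for c
    proof -
      \<comment> \<open>the cups that are opened after \<open>a\<close> and closed again by \<open>c\<close>\<close>
      let ?X = "{(e, f) \<in> C. a < e \<and> f \<le> c}"
      have finX: "finite ?X"
        by (rule finite_subset[OF _ matching_finite[OF cm]]) auto
      have "{a..c} - ?D \<subseteq> snd ` ?X"
      proof
        fix y assume y: "y \<in> {a..c} - ?D"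
        hence "y \<in> cup_ends (cups_within C a b)"
          using cup_ends_cups_within[OF cm ab] c by simp
        then obtain e f where ef: "(e, f) \<in> C" "y = e \<or> y = f" "a \<le> e"
          by (auto simp: cup_ends_def cups_within_def)
        hence "y = f" using y by force
        moreover have "e \<noteq> a" using matching_disjoint[OF cm ab ef(1)] \<open>y = f\<close> y c by auto
        ultimately show "y \<in> snd ` ?X" using ef y by force
      qed
      hence "card ({a..c} - ?D) \<le> card (snd ` ?X)"
        by (intro card_mono finite_imageI finX)
      also have "\<dots> \<le> card ?X" by (rule card_image_le[OF finX])
      also have "\<dots> = card (fst ` ?X)"
        by (rule card_image[symmetric]) (use matching_disjoint[OF cm] in \<open>auto simp: inj_on_def\<close>)
      also have "\<dots> < card ({a..c} \<inter> ?D)"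
      proof (rule psubset_card_mono)
        have "fst ` ?X \<subseteq> {a..c} \<inter> ?D"
          by (auto simp: image_iff dest: matching_bounds(2)[OF cm])
        moreover have "a \<in> {a..c} \<inter> ?D" using ab c by force
        moreover have "a \<notin> fst ` ?X" by auto
        ultimately show "fst ` ?X \<subset> {a..c} \<inter> ?D" by blast
      qed simp
      finally show ?thesis using height_diff[of "a - 1" c ?D] a c by simp
    qed
    ultimately show "x \<in> cup_diagram ?D"
      unfolding x cup_diagram_def using ab lt by force
  qed
  moreover have "cup_diagram ?D \<subseteq> C"
  proof
    fix x assume x: "x \<in> cup_diagram ?D"
    then obtain a b where xab: "x = (a, b)" by (cases x)
    then obtain b' where ab': "(a, b') \<in> C"
      using x by (auto simp: cup_diagram_def)
    have "(a, b') \<in> cup_diagram ?D" using sub ab' by blast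
    with x have "b = b'"
      unfolding xab by (rule cup_diagram_unique)
    thus "x \<in> C" using xab ab' by simp
  qed
  ultimately show ?thesis by blast
qed

lemma cup_diagram_height:
  assumes "(a, b) \<in> cup_diagram D"
  shows "height D b = height D (a - 1)" "b \<notin> D"
proof -
  have ab: "a < b" "height D b \<le> height D (a - 1)" "height D (a - 1) < height D (b - 1)"
    using assms by (auto simp: cup_diagram_def)
  have "height D b = height D (b - 1) + (if b \<in> D then 1 else - 1)"
    using height_Suc[of D "b - 1"] ab by simp
  thus "height D b = height D (a - 1)" "b \<notin> D" using ab by (auto split: if_splits)
qed

text \<open>
  The ballot condition says that the path ends no higher than it was before \<open>a\<close>, so there is a first
  return.
\<close>

lemma cup_diagram_left_end:
  assumes D: "D \<subseteq> {1..n}" and ballot: "\<And>a. a \<in> D \<Longrightarrow> card ({a..n} \<inter> D) \<le> card ({a..n} - D)"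
    and a: "a \<in> D"
  shows "\<exists>b\<le>n. (a, b) \<in> cup_diagram D"
proof -
  have an: "1 \<le> a" "a \<le> n" "Suc (a - 1) = a" using D a by auto
  let ?P = "\<lambda>b. a < b \<and> height D b \<le> height D (a - 1)"
  have ha: "height D a = height D (a - 1) + 1"
    using height_Suc[of D "a - 1"] an a by simp
  have hn: "height D n \<le> height D (a - 1)"
    using height_diff[of "a - 1" n D] ballot[OF a] an by simp
  have Pn: "?P n" using hn ha an by (cases "a = n") auto
  let ?b = "LEAST b. ?P b"
  have Pb: "?P ?b" using Pn by (rule LeastI)
  have "height D (a - 1) < height D c" if "a \<le> c" "c < ?b" for c
    using not_less_Least[OF that(2)] that(1) ha by (cases "a = c") auto
  hence "(a, ?b) \<in> cup_diagram D" using Pb a by (auto simp: cup_diagram_def)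
  moreover have "?b \<le> n" using Pn by (rule Least_le)
  ultimately show ?thesis by blast
qed

text \<open>
  For existence, the condition that does not follow by simply comparing heights is that no down step \<open>c\<close>
  under a cup is a ray: the step at which the path was last at or below its height at \<open>c\<close> lies under
  the same cup and is followed by the up step that is matched with \<open>c\<close>.
\<close>

lemma cup_diagram_crossingless:
  assumes D: "D \<subseteq> {1..n}" and cD: "card D = k"
    and ballot: "\<And>a. a \<in> D \<Longrightarrow> card ({a..n} \<inter> D) \<le> card ({a..n} - D)"
  shows "crossingless_matching n k (cup_diagram D)" "fst ` cup_diagram D = D"
proof -
  let ?C = "cup_diagram D"
  note unique = cup_diagram_unique[of _ _ D]
  have bound: "1 \<le> a \<and> a < b \<and> b \<le> n" if "(a, b) \<in> ?C" for a b
  proof -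
    have "a \<in> D" "a < b" using that by (auto simp: cup_diagram_def)
    moreover have "b \<le> n"
      using cup_diagram_left_end[OF D ballot \<open>a \<in> D\<close>] unique[OF that] by blast
    ultimately show ?thesis using D by auto
  qed
  show fst: "fst ` ?C = D"
  proof
    show "fst ` ?C \<subseteq> D" by (auto simp: cup_diagram_def)
    show "D \<subseteq> fst ` ?C" using cup_diagram_left_end[OF D ballot] by force
  qed
  have "inj_on fst ?C" using unique by (auto simp: inj_on_def)
  hence card: "card ?C = k" using fst cD by (metis card_image)
  have right_unique: "\<not> a < c" if "(a, b) \<in> ?C" "(c, b) \<in> ?C" for a b c
  proof
    assume "a < c"
    hence "height D (a - 1) < height D (c - 1)"
      using cup_diagramD(2)[OF that(2)] by (intro cup_diagramD(4)[OF that(1)]) auto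
    thus False using cup_diagram_height(1)[OF that(1)] cup_diagram_height(1)[OF that(2)] by simp
  qed
  have disj: "{a, b} \<inter> {c, d} = {}" if "(a, b) \<in> ?C" "(c, d) \<in> ?C" "(a, b) \<noteq> (c, d)" for a b c d
  proof -
    have "a \<in> D" "c \<in> D" using that by (auto simp: cup_diagram_def)
    moreover have "b \<notin> D" "d \<notin> D" using cup_diagram_height(2) that by auto
    moreover have "a \<noteq> c" using unique that by blast
    moreover have "b \<noteq> d" using right_unique[of a b c] right_unique[of c b a] that by auto
    ultimately show ?thesis by auto
  qed
  have cross: "\<not> (a < c \<and> c < b \<and> b < d)" if "(a, b) \<in> ?C" "(c, d) \<in> ?C" for a b c d
  proof
    assume *: "a < c \<and> c < b \<and> b < d"
    hence "height D (a - 1) < height D (c - 1)" by (intro cup_diagramD(4)[OF that(1)]) auto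
    moreover have "height D (c - 1) < height D b" using * by (intro cup_diagramD(4)[OF that(2)]) auto
    ultimately show False using cup_diagram_height(1)[OF that(1)] by simp
  qed
  have cover: "c \<in> fst ` ?C \<union> snd ` ?C" if ab: "(a, b) \<in> ?C" and c: "a < c" "c < b" for a b c
  proof (cases "c \<in> D")
    case False
    let ?P = "\<lambda>j. j < c \<and> height D j \<le> height D c"
    let ?j = "GREATEST j. ?P j"
    have "height D a = height D (a - 1) + 1"
      using height_Suc[of D "a - 1"] bound[OF ab] ab by (simp add: cup_diagram_def)
    moreover have "height D (a - 1) < height D c" using ab c by (auto simp: cup_diagram_def)
    ultimately have Pa: "?P a" using c by simp
    have P: "?P ?j" by (rule GreatestI_nat[of ?P a c, OF Pa]) simp
    have above: "height D c < height D i" if "?j < i" "i < c" for i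
      using Greatest_le_nat[of ?P i c] that by force
    have "height D (c - 1) = height D c + 1"
      using height_Suc[of D "c - 1"] False c by simp
    hence "?j \<noteq> c - 1" using P by auto
    hence j: "Suc ?j < c" using P by linarith
    have "Suc ?j \<in> D" and "height D ?j = height D c"
      using above[of "Suc ?j"] j P height_Suc[of D ?j] by (auto split: if_splits)
    hence "(Suc ?j, c) \<in> ?C"
      using above j by (auto simp: cup_diagram_def)
    thus ?thesis by force
  qed (simp add: fst)
  show "crossingless_matching n k ?C"
    unfolding crossingless_matching_def
    using bound card disj cross cover by blast
qed


section \<open>Tableaux\<close>

lemma row_strict_downs:
  assumes "row_strict n k w"
  shows "downs w \<subseteq> {1..n}" "card (downs w) = k" "ups w = {1..n} - downs w" "k \<le> n"
    "distinct (top_row w)" "distinct (bot_row w)"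
proof -
  have ms: "mset (top_row w @ bot_row w) = mset [1..<Suc n]"
    using assms by (simp add: row_strict_def)
  have "distinct (top_row w @ bot_row w)"
    using ms mset_eq_imp_distinct_iff[OF ms] by simp
  hence d: "distinct (top_row w)" "distinct (bot_row w)" "set (top_row w) \<inter> set (bot_row w) = {}"
    by auto
  have "set (top_row w @ bot_row w) = set [1..<Suc n]"
    using arg_cong[OF ms, of set_mset] by (simp only: set_mset_mset)
  hence s: "set (top_row w) \<union> set (bot_row w) = {1..n}"
    by (simp only: set_append set_upt atLeastLessThanSuc_atLeastAtMost)
  show "downs w \<subseteq> {1..n}" unfolding downs_def s[symmetric] by simp
  show "ups w = {1..n} - downs w" unfolding ups_def downs_def s[symmetric] using d(3) by blast
  show c: "card (downs w) = k"
    using assms d by (simp add: downs_def distinct_card row_strict_def)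
  show "distinct (top_row w)" "distinct (bot_row w)" by fact+
  show "k \<le> n" using card_mono[OF _ \<open>downs w \<subseteq> {1..n}\<close>] c by simp
qed

lemma top_count_eq:
  assumes "row_strict n k w" "i \<le> n"
  shows "top_count w i = card ({1..i} - downs w)"
  unfolding top_count_def row_strict_downs(3)[OF assms(1)]
  by (rule arg_cong[where f = card]) (use assms in auto)

lemma bot_count_eq:
  assumes "row_strict n k w"
  shows "bot_count w i = card ({1..i} \<inter> downs w)"
  unfolding bot_count_def
  by (rule arg_cong[where f = card]) (use row_strict_downs(1)[OF assms] in auto)

text \<open>
  Each entry \<open>\<ge> a\<close> of the bottom row has an even larger entry of the top row above it.
\<close>

lemma standard_ballot:
  assumes S: "standard n k S" and kn: "2 * k \<le> n"
  shows "card ({a..n} \<inter> downs S) \<le> card ({a..n} - downs S)"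
proof -
  have rs: "row_strict n k S" and col: "\<And>j. j < k \<Longrightarrow> bot_row S ! j < top_row S ! j"
    using S by (auto simp: standard_def)
  note f = row_strict_downs[OF rs]
  have len: "length (top_row S) = n - k" "length (bot_row S) = k"
    using rs by (auto simp: row_strict_def)
  let ?J = "{j. j < k \<and> a \<le> bot_row S ! j}"
  have "{a..n} \<inter> downs S \<subseteq> (!) (bot_row S) ` ?J"
    by (auto simp: downs_def in_set_conv_nth len)
  hence "card ({a..n} \<inter> downs S) \<le> card ((!) (bot_row S) ` ?J)"
    by (intro card_mono) auto
  also have "\<dots> \<le> card ?J" by (rule card_image_le) simp
  also have "\<dots> = card ((!) (top_row S) ` ?J)"
    by (rule card_image[symmetric]) (use f(5) len kn in \<open>auto simp: inj_on_def nth_eq_iff_index_eq\<close>)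
  also have "\<dots> \<le> card ({a..n} - downs S)"
  proof (rule card_mono)
    show "(!) (top_row S) ` ?J \<subseteq> {a..n} - downs S"
    proof (rule image_subsetI)
      fix j assume j: "j \<in> ?J"
      hence "j < k" by simp
      hence "j < length (top_row S)" using len(1) kn by linarith
      hence "top_row S ! j \<in> ups S" unfolding ups_def by (rule nth_mem)
      moreover have "a \<le> top_row S ! j" using col[of j] j by auto
      ultimately show "top_row S ! j \<in> {a..n} - downs S" using f(3) by auto
    qed
  qed simp
  finally show ?thesis .
qed

lemma standard_matching:
  assumes S: "standard n k S" and kn: "2 * k \<le> n"
  shows "crossingless_matching n k (matching n k S)" "fst ` matching n k S = downs S"
proof -
  have rs: "row_strict n k S" using S by (simp add: standard_def)
  have "\<exists>!C. crossingless_matching n k C \<and> fst ` C = downs S"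
    using cup_diagram_crossingless[OF row_strict_downs(1,2)[OF rs] standard_ballot[OF S kn]]
      matching_eq_cup_diagram by metis
  from theI'[OF this] show "crossingless_matching n k (matching n k S)" "fst ` matching n k S = downs S"
    unfolding matching_def by auto
qed

lemma right_end_eq:
  assumes cm: "crossingless_matching n k (matching n k S)" and ab: "(a, b) \<in> matching n k S"
  shows "right_end n k S a = b"
  unfolding right_end_def
  by (rule the_equality) (use ab matching_disjoint[OF cm ab] in auto)

lemma half_width_eq:
  assumes cm: "crossingless_matching n k (matching n k S)" and ab: "(a, b) \<in> matching n k S"
  shows "half_width n k S a = card (cups_within (matching n k S) a b)"
  using cup_width[OF cm ab] matching_bounds(2)[OF cm ab]
  by (simp add: half_width_def right_end_eq[OF cm ab])

lemma oriented_iff_splits: "oriented (weight w) C \<longleftrightarrow> splits (downs w) C"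
proof -
  have "weight w a \<noteq> weight w b \<longleftrightarrow> (a \<in> downs w) \<noteq> (b \<in> downs w)" for a b
    by (simp add: weight_def)
  thus ?thesis by (simp only: oriented_def splits_def)
qed


section \<open>Coordinate subspaces\<close>

\<comment> \<open>keeps the interval \<open>{1..m}\<close> in the form in which it occurs in the basis\<close>
declare One_nat_def [simp del]

context vector_space
begin

text \<open>
  An invariant subspace that contains a combination of a Jordan chain with leading term \<open>e t\<close> contains the
  whole chain up to \<open>e t\<close>. Applying \<open>f\<close> shifts the coefficients and yields \<open>e 1, \<dots>, e (t - 1)\<close> by induction;
  subtracting their contribution leaves \<open>e t\<close>.
\<close>

lemma jordan_chain_in_invariant_subspace:
  assumes lin: "module_hom scale scale f" and G: "subspace G" "\<And>v. v \<in> G \<Longrightarrow> f v \<in> G"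
    and e: "f (e 1) = 0" "\<And>i. 1 \<le> i \<Longrightarrow> i < m \<Longrightarrow> f (e (Suc i)) = e i"
    and t: "t \<le> m"
    and v: "(\<Sum>i = 1..t. scale (c i) (e i)) \<in> G" "c t \<noteq> 0"
  shows "e ` {1..t} \<subseteq> G"
  using t v
proof (induction t arbitrary: c)
  case (Suc t)
  interpret f: module_hom scale scale f by (rule lin)
  have "f (\<Sum>i = 1..Suc t. scale (c i) (e i)) = (\<Sum>i = 1..Suc t. scale (c i) (f (e i)))"
    by (simp add: f.sum f.scale del: sum.cl_ivl_Suc)
  also have "\<dots> = (\<Sum>i = 1..t. scale (c (Suc i)) (f (e (Suc i))))"
    by (subst sum.atLeast_Suc_atMost) (simp_all only: sum.shift_bounds_cl_Suc_ivl e(1)[unfolded One_nat_def] scale_zero_right add_0_left le_simps(3) One_nat_def zero_less_Suc)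
  also have "\<dots> = (\<Sum>i = 1..t. scale (c (Suc i)) (e i))"
    using Suc.prems(1) e(2) by (intro sum.cong) auto
  finally have "(\<Sum>i = 1..t. scale (c (Suc i)) (e i)) \<in> G"
    using G(2)[OF Suc.prems(2)] by simp
  hence IH: "e ` {1..t} \<subseteq> G"
    using Suc.IH[of "\<lambda>i. c (Suc i)"] Suc.prems by simp
  have "(\<Sum>i = 1..t. scale (c i) (e i)) \<in> G"
    using IH by (intro subspace_sum[OF G(1)] subspace_scale[OF G(1)]) auto
  hence "(\<Sum>i = 1..Suc t. scale (c i) (e i)) - (\<Sum>i = 1..t. scale (c i) (e i)) \<in> G"
    using Suc.prems(2) by (intro subspace_diff[OF G(1)])
  hence "scale (c (Suc t)) (e (Suc t)) \<in> G" by simp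
  hence "scale (inverse (c (Suc t))) (scale (c (Suc t)) (e (Suc t))) \<in> G"
    by (rule subspace_scale[OF G(1)])
  hence "e (Suc t) \<in> G" using Suc.prems(3) by simp
  moreover have "e ` {1..Suc t} = insert (e (Suc t)) (e ` {1..t})"
    by (simp add: atLeastAtMostSuc_conv)
  ultimately show ?case using IH by (simp only: insert_subset simp_thms)
qed simp

end

context two_block
begin

definition E :: "nat \<Rightarrow> nat \<Rightarrow> 'v set" where
  "E t b = span (p ` {1..t} \<union> q ` {1..b})"

text \<open>
  Setting the coordinates outside the range of the indices to \<open>0\<close> makes membership in \<open>E t b\<close> and the
  action of \<open>N\<close> a matter of shifting indices, without boundary cases at the top.
\<close>

definition p_coeff :: "'v \<Rightarrow> nat \<Rightarrow> complex" where
  "p_coeff v i = (if i \<in> {1..n - k} then representation pq_basis v (p i) else 0)"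

definition q_coeff :: "'v \<Rightarrow> nat \<Rightarrow> complex" where
  "q_coeff v i = (if i \<in> {1..k} then representation pq_basis v (q i) else 0)"

lemma coeff_outside:
  "n - k < i \<Longrightarrow> p_coeff v i = 0" "k < i \<Longrightarrow> q_coeff v i = 0"
  by (simp_all add: p_coeff_def q_coeff_def)

lemma coeff_add:
  "p_coeff (u + v) i = p_coeff u i + p_coeff v i" "q_coeff (u + v) i = q_coeff u i + q_coeff v i"
  by (simp_all add: p_coeff_def q_coeff_def representation_add[OF independent_pq] span_pq)

lemma coeff_scale:
  "p_coeff (c *s v) i = c * p_coeff v i" "q_coeff (c *s v) i = c * q_coeff v i"
  by (simp_all add: p_coeff_def q_coeff_def representation_scale[OF independent_pq] span_pq)

lemma coeff_zero: "p_coeff 0 i = 0" "q_coeff 0 i = 0"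
  by (simp_all add: p_coeff_def q_coeff_def representation_zero)

lemma p_neq_q: "i \<in> {1..n - k} \<Longrightarrow> j \<in> {1..k} \<Longrightarrow> p i \<noteq> q j"
  using disjoint_pq by blast

lemma coeff_p:
  assumes "j \<le> n - k"
  shows "p_coeff (p j) i = (if i = j \<and> j \<noteq> 0 then 1 else 0)" "q_coeff (p j) i = 0"
proof -
  have r: "representation pq_basis (p j) = (\<lambda>v. if v = p j then 1 else 0)" if "j \<noteq> 0"
    using assms that by (intro representation_basis independent_pq) auto
  show "p_coeff (p j) i = (if i = j \<and> j \<noteq> 0 then 1 else 0)"
    using assms inj_onD[OF inj_p, of i j]
    by (cases "j = 0") (auto simp: p_coeff_def r p_0 representation_zero)
  show "q_coeff (p j) i = 0"
    using assms p_neq_q[of j i]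
    by (cases "j = 0") (auto simp: q_coeff_def r p_0 representation_zero)
qed

lemma coeff_q:
  assumes "j \<le> k"
  shows "p_coeff (q j) i = 0" "q_coeff (q j) i = (if i = j \<and> j \<noteq> 0 then 1 else 0)"
proof -
  have r: "representation pq_basis (q j) = (\<lambda>v. if v = q j then 1 else 0)" if "j \<noteq> 0"
    using assms that by (intro representation_basis independent_pq) auto
  show "q_coeff (q j) i = (if i = j \<and> j \<noteq> 0 then 1 else 0)"
    using assms inj_onD[OF inj_q, of i j]
    by (cases "j = 0") (auto simp: q_coeff_def r q_0 representation_zero)
  show "p_coeff (q j) i = 0"
    using assms p_neq_q[of i j]
    by (cases "j = 0") (auto simp: p_coeff_def r q_0 representation_zero)
qed

lemma linear_ext_coeff:
  "linear_ext f g v = (\<Sum>i = 1..n - k. p_coeff v i *s f i) + (\<Sum>i = 1..k. q_coeff v i *s g i)"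
  unfolding linear_ext_def by (simp add: p_coeff_def q_coeff_def)

lemma expansion:
  "v = (\<Sum>i = 1..n - k. p_coeff v i *s p i) + (\<Sum>i = 1..k. q_coeff v i *s q i)"
proof -
  have "(\<Sum>b\<in>pq_basis. representation pq_basis v b *s b) = v"
    by (rule sum_representation_eq[OF independent_pq]) (simp_all add: span_pq)
  also have "(\<Sum>b\<in>pq_basis. representation pq_basis v b *s b) =
     (\<Sum>b\<in>p ` {1..n - k}. representation pq_basis v b *s b) +
     (\<Sum>b\<in>q ` {1..k}. representation pq_basis v b *s b)"
    by (rule sum.union_disjoint) (use disjoint_pq in auto)
  finally show ?thesis
    by (simp add: sum.reindex inj_p inj_q p_coeff_def q_coeff_def)
qed

lemma subspace_E: "subspace (E t b)"
  by (simp add: E_def)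

lemma p_in_E: "i \<le> t \<Longrightarrow> p i \<in> E t b"
  unfolding E_def by (cases "i = 0") (auto intro: span_base span_zero simp: p_0)

lemma q_in_E: "i \<le> b \<Longrightarrow> q i \<in> E t b"
  unfolding E_def by (cases "i = 0") (auto intro: span_base span_zero simp: q_0)

lemma mem_E_iff:
  assumes "t \<le> n - k" "b \<le> k"
  shows "v \<in> E t b \<longleftrightarrow> (\<forall>i>t. p_coeff v i = 0) \<and> (\<forall>i>b. q_coeff v i = 0)"
proof
  assume "v \<in> E t b"
  thus "(\<forall>i>t. p_coeff v i = 0) \<and> (\<forall>i>b. q_coeff v i = 0)"
    unfolding E_def
  proof (induction rule: span_induct_alt)
    case base
    show ?case by (simp add: coeff_zero)
  next
    case (step c x y)
    thus ?case using assms by (auto simp: coeff_add coeff_scale coeff_p coeff_q)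
  qed
next
  assume v: "(\<forall>i>t. p_coeff v i = 0) \<and> (\<forall>i>b. q_coeff v i = 0)"
  have "p_coeff v i *s p i \<in> E t b" for i
    by (cases "i \<le> t") (simp_all add: v subspace_scale[OF subspace_E] p_in_E subspace_0[OF subspace_E])
  moreover have "q_coeff v i *s q i \<in> E t b" for i
    by (cases "i \<le> b") (simp_all add: v subspace_scale[OF subspace_E] q_in_E subspace_0[OF subspace_E])
  ultimately have "(\<Sum>i = 1..n - k. p_coeff v i *s p i) + (\<Sum>i = 1..k. q_coeff v i *s q i) \<in> E t b"
    by (intro subspace_add[OF subspace_E] subspace_sum[OF subspace_E])
  thus "v \<in> E t b" by (simp flip: expansion)
qed

lemma E_full: "E (n - k) k = UNIV"
  by (simp add: E_def span_pq)

lemma E_subset_iff: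
  assumes "t \<le> n - k" "b \<le> k" "t' \<le> n - k" "b' \<le> k"
  shows "E t b \<subseteq> E t' b' \<longleftrightarrow> t \<le> t' \<and> b \<le> b'"
proof
  assume "t \<le> t' \<and> b \<le> b'"
  thus "E t b \<subseteq> E t' b'"
    unfolding E_def by (intro span_mono Un_mono image_mono) auto
next
  assume sub: "E t b \<subseteq> E t' b'"
  have "t \<le> t'"
  proof (cases "t = 0")
    case False
    have "p t \<in> E t b" by (simp add: p_in_E)
    hence "p t \<in> E t' b'" using sub by blast
    thus ?thesis using False assms by (auto simp: mem_E_iff coeff_p not_less[symmetric])
  qed simp
  moreover have "b \<le> b'"
  proof (cases "b = 0")
    case False
    have "q b \<in> E t b" by (simp add: q_in_E)
    hence "q b \<in> E t' b'" using sub by blast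
    thus ?thesis using False assms by (auto simp: mem_E_iff coeff_q not_less[symmetric])
  qed simp
  ultimately show "t \<le> t' \<and> b \<le> b'" by simp
qed

lemma E_eq_iff:
  assumes "t \<le> n - k" "b \<le> k" "t' \<le> n - k" "b' \<le> k"
  shows "E t b = E t' b' \<longleftrightarrow> t = t' \<and> b = b'"
  using E_subset_iff[OF assms] E_subset_iff[OF assms(3,4,1,2)] by (metis antisym order_refl)

lemma dim_E:
  assumes "t \<le> n - k" "b \<le> k"
  shows "dim (E t b) = t + b"
proof -
  have sub: "p ` {1..t} \<subseteq> p ` {1..n - k}" "q ` {1..b} \<subseteq> q ` {1..k}"
    using assms by (auto intro!: image_mono)
  have "dim (E t b) = card (p ` {1..t} \<union> q ` {1..b})"
    unfolding E_def using sub
    by (intro dim_span_eq_card_independent independent_mono[OF independent_pq]) blast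
  also have "\<dots> = card (p ` {1..t}) + card (q ` {1..b})"
    using sub disjoint_pq by (intro card_Un_disjoint) auto
  also have "card (p ` {1..t}) = t"
    using inj_on_subset[OF inj_p, of "{1..t}"] assms by (simp add: card_image)
  also have "card (q ` {1..b}) = b"
    using inj_on_subset[OF inj_q, of "{1..b}"] assms by (simp add: card_image)
  finally show ?thesis .
qed

lemma hom_linear_ext: "module_hom (*s) (*s) (linear_ext f g)"
  using linear_linear_ext by (simp add: module_hom_iff_linear)

lemma hom_N_power: "module_hom (*s) (*s) (N ^^ m)"
proof (induction m)
  case 0
  show ?case by unfold_locales simp_all
next
  case (Suc m)
  have "module_hom (*s) (*s) N" unfolding N_def by (rule hom_linear_ext)
  from module_hom_compose[OF Suc this] show ?case by (simp only: funpow.simps)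
qed

lemma N_zero: "N 0 = 0"
  unfolding N_def by (rule module_hom.zero[OF hom_linear_ext])

lemma N_p: "i \<le> n - k \<Longrightarrow> N (p i) = p (i - 1)"
  using N_zero p_0 linear_ext_p[of i] by (cases "i = 0") (auto simp: N_def)

lemma N_q: "i \<le> k \<Longrightarrow> N (q i) = q (i - 1)"
  using N_zero q_0 linear_ext_q[of i] by (cases "i = 0") (auto simp: N_def)

lemma N_power_p: "i \<le> n - k \<Longrightarrow> (N ^^ m) (p i) = p (i - m)"
  by (induction m) (simp_all add: N_p One_nat_def)

lemma N_power_q: "i \<le> k \<Longrightarrow> (N ^^ m) (q i) = q (i - m)"
  by (induction m) (simp_all add: N_q One_nat_def)

lemma coeff_N_power:
  "p_coeff ((N ^^ m) v) i = (if i = 0 then 0 else p_coeff v (i + m))"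
  "q_coeff ((N ^^ m) v) i = (if i = 0 then 0 else q_coeff v (i + m))"
proof -
  interpret Nm: module_hom "(*s)" "(*s)" "N ^^ m" by (rule hom_N_power)
  have "v \<in> span pq_basis" by (simp add: span_pq)
  hence "\<forall>i. p_coeff ((N ^^ m) v) i = (if i = 0 then 0 else p_coeff v (i + m)) \<and>
    q_coeff ((N ^^ m) v) i = (if i = 0 then 0 else q_coeff v (i + m))"
  proof (induction rule: span_induct_alt)
    case base
    show ?case by (simp add: coeff_zero)
  next
    case (step c x y)
    have "\<forall>i. p_coeff ((N ^^ m) x) i = (if i = 0 then 0 else p_coeff x (i + m)) \<and>
      q_coeff ((N ^^ m) x) i = (if i = 0 then 0 else q_coeff x (i + m))"
      using step(1)
    proof (elim UnE imageE)
      fix j assume j: "x = p j" "j \<in> {1..n - k}"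
      hence "(N ^^ m) x = p (j - m)" by (simp add: N_power_p)
      thus ?thesis using j by (auto simp: coeff_p)
    next
      fix j assume j: "x = q j" "j \<in> {1..k}"
      hence "(N ^^ m) x = q (j - m)" by (simp add: N_power_q)
      thus ?thesis using j by (auto simp: coeff_q)
    qed
    thus ?case using step(2) by (simp add: Nm.add Nm.scale coeff_add coeff_scale)
  qed
  thus "p_coeff ((N ^^ m) v) i = (if i = 0 then 0 else p_coeff v (i + m))"
    "q_coeff ((N ^^ m) v) i = (if i = 0 then 0 else q_coeff v (i + m))" by auto
qed

lemma N_power_image_E:
  assumes "t \<le> n - k" "b \<le> k"
  shows "(N ^^ m) ` E t b = E (t - m) (b - m)"
proof -
  interpret Nm: module_hom "(*s)" "(*s)" "N ^^ m" by (rule hom_N_power)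
  have "(N ^^ m) ` E t b = span ((N ^^ m) ` (p ` {1..t} \<union> q ` {1..b}))"
    unfolding E_def by (rule Nm.span_image[symmetric])
  also have "\<dots> = E (t - m) (b - m)"
  proof (rule antisym)
    show "span ((N ^^ m) ` (p ` {1..t} \<union> q ` {1..b})) \<subseteq> E (t - m) (b - m)"
    proof (intro span_minimal subspace_E, safe)
      fix i assume "i \<in> {1..t}"
      thus "(N ^^ m) (p i) \<in> E (t - m) (b - m)"
        using assms by (simp add: N_power_p p_in_E diff_le_mono)
    next
      fix i assume "i \<in> {1..b}"
      thus "(N ^^ m) (q i) \<in> E (t - m) (b - m)"
        using assms by (simp add: N_power_q q_in_E diff_le_mono)
    qed
    show "E (t - m) (b - m) \<subseteq> span ((N ^^ m) ` (p ` {1..t} \<union> q ` {1..b}))"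
      unfolding E_def
    proof (intro span_mono, safe)
      fix i assume i: "i \<in> {1..t - m}"
      hence "p i = (N ^^ m) (p (i + m))" using assms by (subst N_power_p) auto
      thus "p i \<in> (N ^^ m) ` (p ` {1..t} \<union> q ` {1..b})" using i by auto
    next
      fix i assume i: "i \<in> {1..b - m}"
      hence "q i = (N ^^ m) (q (i + m))" using assms by (subst N_power_q) auto
      thus "q i \<in> (N ^^ m) ` (p ` {1..t} \<union> q ` {1..b})" using i by auto
    qed
  qed
  finally show ?thesis .
qed

lemma N_power_range: "range (N ^^ m) = E (n - k - m) (k - m)"
  using N_power_image_E[of "n - k" k m] by (simp add: E_full)

text \<open>
  In contrast to images, preimages are not controlled by the generators alone; in coordinates,
  \<open>N ^^ m\<close> just forgets the first \<open>m\<close> coordinates in each block and shifts the others.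
\<close>

lemma N_power_vimage_E:
  assumes "t + m \<le> n - k" "b + m \<le> k"
  shows "(N ^^ m) -` E t b = E (t + m) (b + m)"
proof (rule set_eqI)
  fix v
  have shift: "(\<forall>i>s. i = 0 \<or> P (i + m)) \<longleftrightarrow> (\<forall>i>s + m. P i)" for P :: "nat \<Rightarrow> bool" and s
  proof safe
    fix i assume *: "\<forall>i>s. i = 0 \<or> P (i + m)" "s + m < i"
    hence "s < i - m" "i - m + m = i" "i - m \<noteq> 0" by auto
    thus "P i" using *(1) by metis
  qed auto
  show "v \<in> (N ^^ m) -` E t b \<longleftrightarrow> v \<in> E (t + m) (b + m)"
    using assms shift[of t "\<lambda>i. p_coeff v i = 0"] shift[of b "\<lambda>i. q_coeff v i = 0"]
    by (simp add: mem_E_iff coeff_N_power if_distrib[of "\<lambda>x. x = 0"])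
qed

lemma torus_image_E:
  assumes "r \<noteq> 0" "s \<noteq> 0" "t \<le> n - k" "b \<le> k"
  shows "torus r s ` E t b = E t b"
proof -
  interpret T: module_hom "(*s)" "(*s)" "torus r s"
    unfolding torus_def by (rule hom_linear_ext)
  have p: "torus r s (p i) = r *s p i" if "i \<in> {1..t}" for i
    unfolding torus_def using that assms by (intro linear_ext_p) auto
  have q: "torus r s (q i) = s *s q i" if "i \<in> {1..b}" for i
    unfolding torus_def using that assms by (intro linear_ext_q) auto
  have sub: "subspace (torus r s ` E t b)"
    by (rule T.subspace_image[OF subspace_E])
  show ?thesis
  proof
    have "torus r s ` E t b = span (torus r s ` (p ` {1..t} \<union> q ` {1..b}))"
      unfolding E_def by (rule T.span_image[symmetric])
    also have "\<dots> \<subseteq> E t b"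
    proof (intro span_minimal subspace_E, safe)
      fix i assume i: "i \<in> {1..t}"
      show "torus r s (p i) \<in> E t b"
        unfolding p[OF i] by (intro subspace_scale[OF subspace_E] p_in_E) (use i in simp)
    next
      fix i assume i: "i \<in> {1..b}"
      show "torus r s (q i) \<in> E t b"
        unfolding q[OF i] by (intro subspace_scale[OF subspace_E] q_in_E) (use i in simp)
    qed
    finally show "torus r s ` E t b \<subseteq> E t b" .
    have "span (p ` {1..t} \<union> q ` {1..b}) \<subseteq> torus r s ` E t b"
    proof (intro span_minimal sub, safe)
      fix i assume i: "i \<in> {1..t}"
      hence "p i \<in> E t b" by (simp add: p_in_E)
      hence "inverse r *s torus r s (p i) \<in> torus r s ` E t b"
        by (intro subspace_scale[OF sub] imageI)
      thus "p i \<in> torus r s ` E t b" using p[OF i] assms by simp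
    next
      fix i assume i: "i \<in> {1..b}"
      hence "q i \<in> E t b" by (simp add: q_in_E)
      hence "inverse s *s torus r s (q i) \<in> torus r s ` E t b"
        by (intro subspace_scale[OF sub] imageI)
      thus "q i \<in> torus r s ` E t b" using q[OF i] assms by simp
    qed
    thus "E t b \<subseteq> torus r s ` E t b" by (simp only: E_def)
  qed
qed

text \<open>
  Torus stability makes the components of the vectors of \<open>G\<close> in the two Jordan blocks lie in \<open>G\<close>; the
  largest indices \<open>t\<close> and \<open>b\<close> that occur in \<open>G\<close> then force the whole chains below them into \<open>G\<close>.
\<close>

lemma invariant_subspace_eq_E:
  assumes G: "subspace G" and N: "N ` G \<subseteq> G"
    and T: "\<And>r s. r \<noteq> 0 \<Longrightarrow> s \<noteq> 0 \<Longrightarrow> torus r s ` G = G"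
  shows "\<exists>t b. t \<le> n - k \<and> b \<le> k \<and> G = E t b"
proof -
  have N1: "module_hom (*s) (*s) N" unfolding N_def by (rule hom_linear_ext)
  have split: "(\<Sum>i = 1..n - k. p_coeff v i *s p i) \<in> G \<and> (\<Sum>i = 1..k. q_coeff v i *s q i) \<in> G"
    if v: "v \<in> G" for v
  proof -
    let ?P = "\<Sum>i = 1..n - k. p_coeff v i *s p i" and ?Q = "\<Sum>i = 1..k. q_coeff v i *s q i"
    \<comment> \<open>the torus element \<open>(2, 1)\<close> separates the two blocks: it moves \<open>v\<close> by exactly its first component\<close>
    have "torus 2 1 v = 2 *s ?P + ?Q"
      by (simp add: torus_def linear_ext_coeff scale_sum_right ac_simps)
    also have "\<dots> = ?P + v"
      using scale_left_distrib[of 1 1 ?P] expansion[of v] by (simp add: add.assoc)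
    finally have "?P = torus 2 1 v - v" by simp
    moreover have "torus 2 1 v \<in> G" using T[of 2 1] v by auto
    ultimately have P: "?P \<in> G" using v by (simp only: subspace_diff[OF G])
    moreover have "?Q = v - ?P" using expansion[of v] by (simp add: algebra_simps)
    ultimately show ?thesis using v by (simp only: subspace_diff[OF G] simp_thms)
  qed
  \<comment> \<open>with \<open>0\<close> included, the maxima exist also if \<open>G\<close> does not meet a block\<close>
  define A where "A = insert 0 {i. \<exists>v\<in>G. p_coeff v i \<noteq> 0}"
  define B where "B = insert 0 {i. \<exists>v\<in>G. q_coeff v i \<noteq> 0}"
  have A: "A \<subseteq> {..n - k}" and B: "B \<subseteq> {..k}"
    using coeff_outside(1,2) unfolding A_def B_def by (auto simp: not_less[symmetric])
  have fin: "finite A" "finite B" using A B finite_subset by blast+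
  define t where "t = Max A"
  define b where "b = Max B"
  have t: "t \<in> A" and b: "b \<in> B"
    unfolding t_def b_def using fin by (intro Max_in; simp add: A_def B_def)+
  have tn: "t \<le> n - k" and bk: "b \<le> k" using t b A B by auto
  have above: "p_coeff v i = 0" if "v \<in> G" "t < i" for v i
    using Max_ge[OF fin(1), of i] that unfolding t_def by (auto simp: A_def)
  have above': "q_coeff v i = 0" if "v \<in> G" "b < i" for v i
    using Max_ge[OF fin(2), of i] that unfolding b_def by (auto simp: B_def)
  have "p ` {1..t} \<subseteq> G"
  proof (cases "t = 0")
    case False
    then obtain v where v: "v \<in> G" "p_coeff v t \<noteq> 0" using t by (auto simp: A_def)
    have "(\<Sum>i = 1..n - k. p_coeff v i *s p i) = (\<Sum>i = 1..t. p_coeff v i *s p i)"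
      using tn above[OF v(1)] by (intro sum.mono_neutral_right) auto
    hence "(\<Sum>i = 1..t. p_coeff v i *s p i) \<in> G" using split[OF v(1)] by simp
    thus ?thesis
      using N tn v(2) False
      by (intro jordan_chain_in_invariant_subspace[OF N1 G, where m = "n - k" and c = "p_coeff v"])
        (auto simp: N_p p_0)
  qed simp
  moreover have "q ` {1..b} \<subseteq> G"
  proof (cases "b = 0")
    case False
    then obtain v where v: "v \<in> G" "q_coeff v b \<noteq> 0" using b by (auto simp: B_def)
    have "(\<Sum>i = 1..k. q_coeff v i *s q i) = (\<Sum>i = 1..b. q_coeff v i *s q i)"
      using bk above'[OF v(1)] by (intro sum.mono_neutral_right) auto
    hence "(\<Sum>i = 1..b. q_coeff v i *s q i) \<in> G" using split[OF v(1)] by simp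
    thus ?thesis
      using N bk v(2) False
      by (intro jordan_chain_in_invariant_subspace[OF N1 G, where m = k and c = "q_coeff v"])
        (auto simp: N_q q_0)
  qed simp
  ultimately have "E t b \<subseteq> G"
    unfolding E_def by (intro span_minimal G) auto
  moreover have "G \<subseteq> E t b"
    using above above' by (auto simp: mem_E_iff[OF tn bk])
  ultimately show ?thesis using tn bk by blast
qed

end


section \<open>Torus fixed points and components\<close>

context two_block
begin

text \<open>
  The flag of the row strict tableau with bottom row \<open>D\<close>. A row strict tableau is determined by the set
  of the entries of its bottom row, so these sets index the fixed points without repetition.
\<close>

definition subset_flag :: "nat set \<Rightarrow> nat \<Rightarrow> 'v set" where
  "subset_flag D = (\<lambda>i\<in>{..n}. E (card ({1..i} - D)) (card ({1..i} \<inter> D)))"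

lemma subset_counts:
  assumes "D \<subseteq> {1..n}" "card D = k" "i \<le> n"
  shows "card ({1..i} - D) \<le> n - k" "card ({1..i} \<inter> D) \<le> k"
    "card ({1..i} - D) + card ({1..i} \<inter> D) = i"
proof -
  have fin: "finite D" using assms(1) finite_subset by blast
  have "card ({1..i} - D) \<le> card ({1..n} - D)" using assms(3) by (intro card_mono) auto
  thus "card ({1..i} - D) \<le> n - k" using assms fin by (simp add: card_Diff_subset)
  show "card ({1..i} \<inter> D) \<le> k" using card_mono[OF fin, of "{1..i} \<inter> D"] assms(2) by simp
  show "card ({1..i} - D) + card ({1..i} \<inter> D) = i"
    using card_Int_Diff[of "{1..i}" D] by simp
qed

lemma card_interval_split:
  fixes D :: "nat set"
  assumes "i \<le> j"
  shows "card ({1..j} \<inter> D) = card ({1..i} \<inter> D) + card ({Suc i..j} \<inter> D)"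
  by (subst card_Un_disjoint[symmetric]) (use assms in \<open>auto intro!: arg_cong[where f = card]\<close>)

lemma card_interval_mono:
  fixes D :: "nat set"
  assumes "i \<le> j"
  shows "card ({1..i} \<inter> D) \<le> card ({1..j} \<inter> D)" "card ({1..i} - D) \<le> card ({1..j} - D)"
  by (rule card_mono; use assms in auto)+

lemma tableau_flag_eq:
  assumes "row_strict n k w"
  shows "tableau_flag w = subset_flag (downs w)"
  unfolding tableau_flag_def subset_flag_def E_def
  by (rule restrict_ext) (simp add: top_count_eq[OF assms] bot_count_eq[OF assms])

lemma subset_flag_in_springer_fiber:
  assumes D: "D \<subseteq> {1..n}" "card D = k"
  shows "subset_flag D \<in> springer_fiber"
proof -
  note le = subset_counts(1,2)[OF D]
  have "complete_flag (subset_flag D)"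
    unfolding complete_flag_def
  proof (intro conjI allI impI)
    show "subset_flag D \<in> extensional {..n}" by (simp add: subset_flag_def)
    fix i assume i: "i \<le> n"
    show "subspace (subset_flag D i)" using i by (simp add: subset_flag_def subspace_E)
    show "dim (subset_flag D i) = i"
      using i le[OF i] subset_counts(3)[OF D i] by (simp add: subset_flag_def dim_E)
  next
    fix i assume i: "i < n"
    have "E (card ({1..i} - D)) (card ({1..i} \<inter> D)) \<subseteq> E (card ({1..Suc i} - D)) (card ({1..Suc i} \<inter> D))"
      using i by (subst E_subset_iff) (auto intro!: le card_interval_mono simp del: One_nat_def)
    thus "subset_flag D i \<subseteq> subset_flag D (Suc i)"
      using i by (simp add: subset_flag_def)
  qed
  moreover have "N ` subset_flag D i \<subseteq> subset_flag D (i - 1)" if i: "i \<in> {1..n}" for i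
  proof -
    let ?t = "\<lambda>i. card ({1..i} - D)" and ?b = "\<lambda>i. card ({1..i} \<inter> D)"
    have i': "i \<le> n" "i - 1 \<le> n" "i = Suc (i - 1)" using i by auto
    have "?b i - 1 \<le> ?b (i - 1)" "?t i - 1 \<le> ?t (i - 1)"
      using card_interval_mono[of "i - 1" i D] subset_counts(3)[OF D i'(1)] subset_counts(3)[OF D i'(2)] i'
      by linarith+
    hence "E (?t i - 1) (?b i - 1) \<subseteq> E (?t (i - 1)) (?b (i - 1))"
      using le[OF i'(1)] le[OF i'(2)] by (subst E_subset_iff) linarith+
    moreover have "N ` E (?t i) (?b i) = E (?t i - 1) (?b i - 1)"
      using N_power_image_E[OF le[OF i'(1)], of 1] by (simp add: One_nat_def)
    ultimately show ?thesis using i' by (simp add: subset_flag_def)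
  qed
  ultimately show ?thesis by (simp add: springer_fiber_def)
qed

lemma subset_flag_torus_fixed:
  assumes D: "D \<subseteq> {1..n}" "card D = k"
  shows "subset_flag D \<in> torus_fixed_points"
  unfolding torus_fixed_points_def
  using subset_flag_in_springer_fiber[OF D] torus_image_E[OF _ _ subset_counts(1,2)[OF D]]
  by (auto simp: subset_flag_def)

text \<open>
  The flag determines how many elements of \<open>D\<close> lie in each \<open>{1..i}\<close>, hence which points lie in \<open>D\<close>.
\<close>

lemma inj_subset_flag: "inj_on subset_flag {D. D \<subseteq> {1..n} \<and> card D = k}"
proof (rule inj_onI)
  have transfer: "x \<in> D'" if D: "D \<subseteq> {1..n}" "card D = k" and D': "D' \<subseteq> {1..n}" "card D' = k"
    and eq: "subset_flag D = subset_flag D'" and x: "x \<in> D" for D D' x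
  proof -
    have b: "card ({1..i} \<inter> D) = card ({1..i} \<inter> D')" if i: "i \<le> n" for i
    proof -
      have "E (card ({1..i} - D)) (card ({1..i} \<inter> D)) = E (card ({1..i} - D')) (card ({1..i} \<inter> D'))"
        using fun_cong[OF eq, of i] i by (simp add: subset_flag_def)
      thus ?thesis
        using subset_counts(1,2)[OF D i] subset_counts(1,2)[OF D' i] by (simp add: E_eq_iff)
    qed
    have "1 \<le> x" "x \<le> n" using x D by auto
    hence x': "x \<le> n" "x - 1 \<le> n" "Suc (x - 1) = x" by linarith+
    have "card ({x..x} \<inter> D) = card ({x..x} \<inter> D')"
      using b[OF x'(1)] b[OF x'(2)] card_interval_split[of "x - 1" x] x'(3) by simp
    thus "x \<in> D'" using x by (cases "x \<in> D'") auto
  qed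
  fix D D' assume D: "D \<in> {D. D \<subseteq> {1..n} \<and> card D = k}" "D' \<in> {D. D \<subseteq> {1..n} \<and> card D = k}"
    and eq: "subset_flag D = subset_flag D'"
  have *: "D \<subseteq> {1..n}" "card D = k" "D' \<subseteq> {1..n}" "card D' = k" using D by auto
  show "D = D'"
    by (intro subset_antisym subsetI)
      (fact transfer[OF * eq], fact transfer[OF *(3,4,1,2) eq[symmetric]])
qed

text \<open>
  Each member of the flag is some \<open>E t b\<close> with \<open>t + b = i\<close>. From one member to the next, exactly one of
  \<open>t\<close> and \<open>b\<close> increases, and \<open>D\<close> records the steps at which it is \<open>b\<close>.
\<close>

lemma torus_fixed_point_is_subset_flag:
  assumes kn: "k \<le> n" and F: "F \<in> torus_fixed_points"
  shows "\<exists>D. D \<subseteq> {1..n} \<and> card D = k \<and> F = subset_flag D"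
proof -
  have ext: "F \<in> extensional {..n}" and sub: "\<And>i. i \<le> n \<Longrightarrow> subspace (F i)"
    and dim: "\<And>i. i \<le> n \<Longrightarrow> dim (F i) = i" and mono: "\<And>i. i < n \<Longrightarrow> F i \<subseteq> F (Suc i)"
    and N: "\<And>i. i \<in> {1..n} \<Longrightarrow> N ` F i \<subseteq> F (i - 1)"
    and T: "\<And>r s i. r \<noteq> 0 \<Longrightarrow> s \<noteq> 0 \<Longrightarrow> i \<le> n \<Longrightarrow> torus r s ` F i = F i"
    using F unfolding torus_fixed_points_def springer_fiber_def complete_flag_def by auto
  have NF: "N ` F i \<subseteq> F i" if i: "i \<le> n" for i
  proof (cases i)
    case 0
    \<comment> \<open>\<open>card B = 0\<close> alone would also allow an infinite \<open>B\<close>\<close>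
    obtain B where B: "independent B" "F 0 \<subseteq> span B" "card B = dim (F 0)"
      using basis_exists[of "F 0"] by blast
    have "finite B"
      using independent_span_bound[OF _ B(1), of pq_basis] by (simp add: span_pq)
    hence "F 0 \<subseteq> {0}" using B dim[of 0] by simp
    thus ?thesis using 0 subspace_0[OF sub[of 0]] N_zero by auto
  next
    case (Suc j)
    thus ?thesis using N[of i] mono[of j] i by auto
  qed
  have "\<forall>i\<in>{..n}. \<exists>t b. t \<le> n - k \<and> b \<le> k \<and> F i = E t b"
    using invariant_subspace_eq_E[OF sub NF] T by auto
  then obtain t b where tb: "\<And>i. i \<le> n \<Longrightarrow> t i \<le> n - k" "\<And>i. i \<le> n \<Longrightarrow> b i \<le> k"
    "\<And>i. i \<le> n \<Longrightarrow> F i = E (t i) (b i)"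
    unfolding bchoice_iff by (metis atMost_iff)
  have sum: "t i + b i = i" if "i \<le> n" for i
    using dim[OF that] dim_E[OF tb(1,2)[OF that]] tb(3)[OF that] by simp
  have step: "t i \<le> t (Suc i) \<and> b i \<le> b (Suc i)" if "i < n" for i
    using mono[OF that] tb(3)[of i] tb(3)[of "Suc i"] that
      E_subset_iff[OF tb(1,2)[of i] tb(1,2)[of "Suc i"]] by simp
  define D where "D = {i \<in> {1..n}. b (i - 1) < b i}"
  have D: "D \<subseteq> {1..n}" by (auto simp: D_def)
  have bD: "card ({1..i} \<inter> D) = b i" if "i \<le> n" for i
    using that
  proof (induction i)
    case 0
    thus ?case using sum[of 0] by simp
  next
    case (Suc i)
    have "card ({1..Suc i} \<inter> D) = b i + card ({Suc i..Suc i} \<inter> D)"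
      using Suc card_interval_split[of i "Suc i" D] by simp
    also have "card ({Suc i..Suc i} \<inter> D) = (if Suc i \<in> D then 1 else 0)" by simp
    also have "\<dots> = b (Suc i) - b i"
      using Suc.prems step[of i] sum[of i] sum[of "Suc i"] by (auto simp: D_def)
    finally show ?case using step[of i] Suc.prems by simp
  qed
  have "b n = k" using sum[of n] tb(1,2)[of n] kn by simp
  moreover have "{1..n} \<inter> D = D" using D by blast
  ultimately have cD: "card D = k" using bD[of n] by simp
  have "F = subset_flag D"
  proof (rule extensionalityI[OF ext])
    show "subset_flag D \<in> extensional {..n}" by (simp add: subset_flag_def)
    fix i assume "i \<in> {..n}"
    hence i: "i \<le> n" by simp
    have "card ({1..i} - D) = t i"
      using subset_counts(3)[OF D cD i] bD[OF i] sum[OF i] by simp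
    thus "F i = subset_flag D i" using i bD[OF i] tb(3)[OF i] by (simp add: subset_flag_def)
  qed
  thus ?thesis using D cD by blast
qed

text \<open>
  \<open>N ^^ d\<close> lowers both indices by \<open>d\<close>, so the flag has to gain \<open>d\<close> in both of them between \<open>a - 1\<close> and
  \<open>b\<close>. The truncation at \<open>0\<close> cannot produce further solutions: if one index gained less than \<open>d\<close>, the other
  one would gain more, and its equation would fail.
\<close>

lemma cup_condition_iff:
  assumes D: "D \<subseteq> {1..n}" "card D = k" and ab: "1 \<le> a" "a \<le> b" "b \<le> n" "b + 1 - a = 2 * d"
  shows "(N ^^ d) ` subset_flag D b = subset_flag D (a - 1) \<longleftrightarrow> card ({a..b} \<inter> D) = d"
proof -
  let ?t = "\<lambda>i. card ({1..i} - D)" and ?b = "\<lambda>i. card ({1..i} \<inter> D)"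
  have a: "a - 1 \<le> n" "Suc (a - 1) = a" using ab by auto
  note le = subset_counts(1,2)[OF D ab(3)] subset_counts(1,2)[OF D a(1)]
  have "(N ^^ d) ` subset_flag D b = E (?t b - d) (?b b - d)"
    using ab N_power_image_E[OF le(1,2), of d] by (simp add: subset_flag_def)
  moreover have "subset_flag D (a - 1) = E (?t (a - 1)) (?b (a - 1))"
    using a by (simp add: subset_flag_def)
  moreover have "E (?t b - d) (?b b - d) = E (?t (a - 1)) (?b (a - 1)) \<longleftrightarrow>
      ?t b - d = ?t (a - 1) \<and> ?b b - d = ?b (a - 1)"
    using le by (intro E_eq_iff) linarith+
  moreover have "?b b = ?b (a - 1) + card ({a..b} \<inter> D)"
    using card_interval_split[of "a - 1" b D] a ab by simp
  moreover have "?t b + ?b b = b" "?t (a - 1) + ?b (a - 1) = a - 1" "?t (a - 1) \<le> ?t b"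
    using subset_counts(3)[OF D ab(3)] subset_counts(3)[OF D a(1)] card_interval_mono(2)[of "a - 1" b D] ab
    by simp_all
  moreover have "x - d = x' \<and> y - d = y' \<longleftrightarrow> c = d"
    if "x + y = b" "x' + y' = a - 1" "x' \<le> x" "y = y' + c" for x x' y y' c
    using that ab by arith
  ultimately show ?thesis by simp
qed

text \<open>
  The second inequality kills the block of length \<open>k\<close> in the range of the power of \<open>N\<close>, which leaves
  \<open>E (t - b) 0\<close>; its preimage is \<open>E t b\<close> by the first inequality.
\<close>

lemma ray_condition:
  assumes D: "D \<subseteq> {1..n}" "card D = k" and i: "i \<le> n"
    and b: "card ({1..i} \<inter> D) = b" and t: "card ({1..i} - D) = t"
    and bt: "b \<le> t" "t + k \<le> n - k + b"
  shows "subset_flag D i = (N ^^ b) -` range (N ^^ (n - k - t + b))"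
proof -
  have le: "t \<le> n - k" "b \<le> k" using subset_counts(1,2)[OF D i] b t by auto
  have "range (N ^^ (n - k - t + b)) = E (t - b) 0"
    using le bt unfolding N_power_range by (intro arg_cong2[where f = E]) linarith+
  moreover have "(N ^^ b) -` E (t - b) 0 = E t b"
    using N_power_vimage_E[of "t - b" b 0] le bt by simp
  ultimately show ?thesis using i b t by (simp add: subset_flag_def)
qed

text \<open>
  The cup conditions alone characterise orientedness; the ray conditions then hold because the counts at
  a ray are the same for \<open>D\<close> as for the bottom row of \<open>S\<close>. The inequalities of \<open>ray_condition\<close>
  express that each cup to the left of the ray contains two points, and that the bottom row of \<open>S\<close>
  does not outnumber the top row to the right of it.
\<close>

lemma subset_flag_in_component_iff:
  assumes S: "standard n k S" and kn: "2 * k \<le> n" and D: "D \<subseteq> {1..n}" "card D = k"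
  shows "subset_flag D \<in> component S \<longleftrightarrow> splits D (matching n k S)"
proof -
  let ?C = "matching n k S"
  note cm = standard_matching(1)[OF S kn] and fst = standard_matching(2)[OF S kn]
  have rs: "row_strict n k S" using S by (simp add: standard_def)
  note d = row_strict_downs[OF rs]
  have cup: "(N ^^ half_width n k S a) ` subset_flag D (right_end n k S a) = subset_flag D (a - 1)
      \<longleftrightarrow> card ({a..b} \<inter> D) = card (cups_within ?C a b)" if ab: "(a, b) \<in> ?C" for a b
    unfolding half_width_eq[OF cm ab] right_end_eq[OF cm ab]
    using matching_bounds[OF cm ab] cup_width[OF cm ab] by (intro cup_condition_iff D) auto
  have cups: "(\<forall>a\<in>downs S. (N ^^ half_width n k S a) ` subset_flag D (right_end n k S a) =
      subset_flag D (a - 1)) \<longleftrightarrow> splits D ?C"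
    unfolding splits_iff_balanced[OF cm] fst[symmetric] using cup by fastforce
  have rays: "subset_flag D i = (N ^^ bot_count S i) -`
      range (N ^^ (n - k - top_count S i + bot_count S i))"
    if sp: "splits D ?C" and i: "i \<in> ups S - right_end n k S ` downs S" for i
  proof -
    have i1: "1 \<le> i" "i \<le> n" "i \<notin> downs S" using i d(3) by auto
    have "i \<notin> snd ` ?C"
    proof
      assume "i \<in> snd ` ?C"
      then obtain a where a: "(a, i) \<in> ?C" by auto
      hence "a \<in> downs S" using fst by force
      thus False using i right_end_eq[OF cm a] by blast
    qed
    hence ray: "i \<notin> cup_ends ?C" using i1 fst by (simp add: cup_ends_eq)
    let ?w = "card (cups_within ?C 1 i)"
    have fin: "finite D" "finite (downs S)" using D d(1) finite_subset by blast+
    have bD: "card ({1..i} \<inter> D) = ?w"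
      by (rule card_below_ray[OF cm sp fin(1) D(2,1) ray])
    have bS: "card ({1..i} \<inter> downs S) = ?w"
      using card_below_ray[OF cm _ fin(2) d(2,1) ray] splits_fst[OF cm] fst by simp
    have b: "bot_count S i = ?w" using bot_count_eq[OF rs] bS by simp
    have tS: "card ({1..i} - downs S) + ?w = i"
      using subset_counts(3)[OF d(1,2) i1(2)] bS by simp
    have tD: "card ({1..i} - D) + ?w = i"
      using subset_counts(3)[OF D i1(2)] bD by simp
    have t: "card ({1..i} - D) = top_count S i"
      using top_count_eq[OF rs i1(2)] tS tD by simp
    have "cup_ends (cups_within ?C 1 i) \<subseteq> {1..i}"
      using matching_bounds[OF cm] by (force simp: cup_ends_def cups_within_def)
    hence "card (cup_ends (cups_within ?C 1 i)) \<le> i"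
      using card_mono[of "{1..i}"] by fastforce
    moreover have "card (cup_ends (cups_within ?C 1 i)) = 2 * ?w"
      by (rule card_cup_ends[OF cm]) (auto simp: cups_within_def)
    ultimately have "?w \<le> top_count S i" using t tD by simp
    moreover have "top_count S i + k \<le> n - k + ?w"
    proof -
      have "card ({Suc i..n} \<inter> downs S) \<le> card ({Suc i..n} - downs S)"
        by (rule standard_ballot[OF S kn])
      moreover have "card ({Suc i..n} - downs S) + card ({Suc i..n} \<inter> downs S) = n - i"
        using card_Int_Diff[of "{Suc i..n}" "downs S"] by simp
      moreover have "{1..n} \<inter> downs S = downs S" using d(1) by blast
      hence "card ({Suc i..n} \<inter> downs S) + ?w = k"
        using card_interval_split[OF i1(2), of "downs S"] bS d(2) by simp
      ultimately show ?thesis using t tD kn i1 by linarith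
    qed
    ultimately show ?thesis
      unfolding b by (intro ray_condition D i1 bD t)
  qed
  show ?thesis
    unfolding component_def
    using cups rays subset_flag_in_springer_fiber[OF D] by blast
qed

end

theorem lemma12:
  fixes scale :: "complex \<Rightarrow> 'v::ab_group_add \<Rightarrow> 'v"
    and n k :: nat
    and p q :: "nat \<Rightarrow> 'v"
  assumes "two_block scale n k p q"
    and "2 * k \<le> n"
  shows "(\<forall>w S. row_strict n k w \<longrightarrow> standard n k S \<longrightarrow>
            (two_block.tableau_flag scale n p q w \<in> two_block.component scale n k p q S
              \<longleftrightarrow> oriented (weight w) (matching n k S))) \<and>
         (\<forall>S. standard n k S \<longrightarrow>
            card (two_block.component scale n k p q S \<inter>
                  two_block.torus_fixed_points scale n k p q) = 2 ^ k)"
proof (intro conjI allI impI)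
  interpret two_block scale n k p q by (rule assms(1))
  fix w S assume w: "row_strict n k w" and S: "standard n k S"
  show "tableau_flag w \<in> component S \<longleftrightarrow> oriented (weight w) (matching n k S)"
    unfolding tableau_flag_eq[OF w] oriented_iff_splits
    by (rule subset_flag_in_component_iff[OF S assms(2) row_strict_downs(1,2)[OF w]])
next
  interpret two_block scale n k p q by (rule assms(1))
  fix S assume S: "standard n k S"
  let ?\<D> = "{D. D \<subseteq> {1..n} \<and> card D = k \<and> splits D (matching n k S)}"
  have "component S \<inter> torus_fixed_points = subset_flag ` ?\<D>"
  proof (intro subset_antisym subsetI)
    fix F assume F: "F \<in> component S \<inter> torus_fixed_points"
    then obtain D where D: "D \<subseteq> {1..n}" "card D = k" "F = subset_flag D"
      using torus_fixed_point_is_subset_flag[of F] assms(2) by auto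
    thus "F \<in> subset_flag ` ?\<D>"
      using F subset_flag_in_component_iff[OF S assms(2) D(1,2)] by blast
  next
    fix F assume "F \<in> subset_flag ` ?\<D>"
    then obtain D where D: "D \<subseteq> {1..n}" "card D = k" "splits D (matching n k S)" "F = subset_flag D"
      by blast
    thus "F \<in> component S \<inter> torus_fixed_points"
      using subset_flag_in_component_iff[OF S assms(2) D(1,2)] subset_flag_torus_fixed[OF D(1,2)]
      by blast
  qed
  moreover have "inj_on subset_flag ?\<D>"
    by (rule inj_on_subset[OF inj_subset_flag]) auto
  ultimately show "card (component S \<inter> torus_fixed_points) = 2 ^ k"
    using card_splitting_sets[OF standard_matching(1)[OF S assms(2)]] by (simp add: card_image)
qed

end
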